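(* Let $t,s,u,r\ge 1$ be integers, let $P_1,P_2>0$, and let $\mathbf{H}_0\in\mathbb{C}^{r\times t}$, $\mathbf{H}_1\in\mathbb{C}^{s\times t}$, $\mathbf{H}_2\in\mathbb{C}^{r\times u}$ be given. For a symbol rate $R>0$ and a matrix $\mathbf{X}\in\mathbb{C}^{u\times s}$ define $$C_{\mathsf{OSTBC}}(\mathbf{X})=R\log_2\Big\{1+\frac{P_1}{tR}\operatorname{tr}\Big[\mathbf{H}_0^{H}\mathbf{H}_0+\mathbf{H}_1^{H}\mathbf{X}^{H}\mathbf{H}_2^{H}\big(\mathbf{I}_r+\mathbf{H}_2\mathbf{X}\mathbf{X}^{H}\mathbf{H}_2^{H}\big)^{-1}\mathbf{H}_2\mathbf{X}\mathbf{H}_1\Big]\Big\}.$$ Define $$\check{\mathbf{A}}=\mathbf{H}_1\mathbf{H}_1^{H},\qquad \check{\mathbf{B}}=\mathbf{H}_2^{H}\mathbf{H}_2,\qquad \mathbf{C}=\mathbf{I}_s+\frac{P_1}{t}\mathbf{H}_1\mathbf{H}_1^{H}.$$ Let $\rho_B=\operatorname{rank}(\check{\mathbf{B}})=\operatorname{rank}(\mathbf{H}_2)$ and $\rho=\min(s,\rho_B)$. Let $\alpha_1\ge\dots\ge\alpha_s$ be the eigenvalues of $\check{\mathbf{A}}$ with corresponding orthonormal eigenvectors $\mathbf{a}_1,\dots,\mathbf{a}_s\in\mathbb{C}^s$, and let $\mu_1\ge\dots\ge\mu_{\rho_B}>0$ be the positive eigenvalues of $\check{\mathbf{B}}$ with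 corresponding orthonormal eigenvectors $\mathbf{b}_1,\dots,\mathbf{b}_{\rho_B}\in\mathbb{C}^u$. For $i=1,\dots,\rho$ set $\beta_i=\mathbf{a}_i^{H}\mathbf{C}\mathbf{a}_i/\mu_i$. Let $(x_1,\dots,x_\rho)$ be a solution of the optimization problem $$\min_{x_1,\dots,x_\rho}\;\sum_{i=1}^{\rho}\frac{\alpha_i}{1+x_i}\quad\text{s.t.}\quad\sum_{i=1}^{\rho}\beta_i x_i\le P_2,\ \ x_i\ge 0,\ i=1,\dots,\rho.$$ Then the matrix $$\mathbf{X}=\widetilde{\mathbf{U}}_B\widetilde{\boldsymbol{\Lambda}}_B^{-1/2}\widetilde{\boldsymbol{\Lambda}}^{1/2}\widetilde{\mathbf{U}}_A^{H}=\sum_{i=1}^{\rho}\sqrt{\frac{x_i}{\mu_i}}\;\mathbf{b}_i\mathbf{a}_i^{H},$$ where $\widetilde{\mathbf{U}}_B=[\mathbf{b}_1,\dots,\mathbf{b}_{\rho_B}]$, $\widetilde{\boldsymbol{\Lambda}}_B=\mathrm{diag}(\mu_1,\dots,\mu_{\rho_B})$, $\widetilde{\boldsymbol{\Lambda}}=\mathrm{diag}(x_1,\dots,x_\rho,0,\dots,0)$ ($\rho_B\times\rho_B$) and $\widetilde{\mathbf{U}}_A$ has columns $\mathbf{a}_1,\mathbf{a}_2,\dots$, maximizes $C_{\mathsf{OSTBC}}(\mathbf{X})$ (for every $R>0$) over all $\mathbf{X}\in\mathbb{C}^{u\times s}$ subject to $\operatorname{tr}\{\mathbf{X}\mathbf{C}\mathbf{X}^{H}\}\le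 P_2$.
   Context: This models a two-hop amplify-and-forward MIMO relay network with a direct link: source with $t$ antennas transmitting power $P_1$, destination with $r$ antennas, relay with $s$ receive and $u$ transmit antennas applying the relay transform matrix $\mathbf{X}$; $\mathbf{H}_0,\mathbf{H}_1,\mathbf{H}_2$ are the source–destination, source–relay and relay–destination channel matrices, all noises are i.i.d. unit-variance circularly-symmetric complex Gaussian. $C_{\mathsf{OSTBC}}$ is the capacity achievable with orthogonal space–time block codes of symbol rate $R$, and $\operatorname{tr}\{\mathbf{X}\mathbf{C}\mathbf{X}^H\}$ is the average relay transmit power. $(\cdot)^H$ denotes conjugate transpose. *)

theory Defs
  imports "HOL-Analysis.Analysis"
begin

definition adj :: "complex^'n^'m \<Rightarrow> complex^'m^'n" where
  "adj A = (\<chi> i j. cnj (A $ j $ i))"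

definition cinner :: "complex^'n \<Rightarrow> complex^'n \<Rightarrow> complex" where
  "cinner v w = (\<Sum>k\<in>UNIV. cnj (v $ k) * w $ k)"

definition outer :: "complex^'m \<Rightarrow> complex^'n \<Rightarrow> complex^'n^'m" where
  "outer v w = (\<chi> i j. v $ i * cnj (w $ j))"

definition C_OSTBC ::
  "real \<Rightarrow> real \<Rightarrow> complex^'t^'r \<Rightarrow> complex^'t^'s \<Rightarrow> complex^'u^'r \<Rightarrow> complex^'s^'u \<Rightarrow> real" where
  "C_OSTBC R P1 H0 H1 H2 X =
     R * log 2 (1 + P1 / (real CARD('t) * R) *
       Re (trace (adj H0 ** H0 +
                  adj H1 ** adj X ** adj H2 **
                  matrix_inv (mat 1 + H2 ** X ** adj X ** adj H2) **
                  H2 ** X ** H1)))"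

end

(* Write A = H1 H1^H, B = H2^H H2, k = P1/t, C = I + k A, M = X^H B X and G = (I + M)^-1. By the
   push-through identity the trace in the capacity is, up to a constant, tr A - tr (A G). The problem is
   not convex, so one looks at a global optimum Y, which exists by compactness.
   Bounding tr (A G) by the mean square error of a fixed linear estimator, a quadratic in Y, yields the stationarity condition B Y (G A G) = n Y C. It makes
   C M G A G Hermitian, and this forces M to commute with A. In a common eigenbasis (w) of A and M the
   vectors Y w are, for the modes that matter, orthogonal eigenvectors of B. Hence the optimum only pairs
   eigenvalues of A with eigenvalues of B, and by an exchange argument the pairing of both in decreasing
   order is best, which leaves the scalar problem solved by x. *)
theory Submission
  imports Defs
begin

section \<open>Adjoints and inner products\<close>

text \<open>The weight \<open>C\<close> in the power contains \<open>A\<close>, so the modes with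
  the largest gain are also the most expensive to feed. The sorting argument is therefore not run on
  an arbitrary matrix: structure is extracted only at an optimum, whose value then bounds every
  feasible matrix. The inverse \<open>G\<close> is never differentiated, nor is its continuity used.
  The quantity tr (A G) has two variational forms, both obtained by completing a square: a minimum
  over estimators \<open>U\<close> of functions quadratic in \<open>Y\<close>, and a maximum over
  \<open>V\<close> of functions continuous in \<open>Y\<close>. The minimum supplies a majorant that
  touches the objective at the optimum, hence the first-order condition; the maximum supplies lower
  semicontinuity, hence existence. Repeated eigenvalues are the remaining obstacle. The common
  eigenbasis of A and M need not consist of the prescribed \<open>a\<close>, nor the normalized
  images Y w of the prescribed \<open>b\<close>. Only eigenvalues are matched, with multiplicity, by
  a counting argument in each eigenspace. Modes without gain yield no information from the
  first-order condition; they are discarded, which can only lower the power.\<close>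

lemma adj_adj [simp]: "adj (adj A) = A"
  by (simp add: adj_def vec_eq_iff)

lemma adj_mult: "adj (A ** B) = adj B ** adj A"
  by (simp add: adj_def vec_eq_iff matrix_matrix_mult_def mult.commute)

lemma adj_add: "adj (A + B) = adj A + adj B"
  by (simp add: adj_def vec_eq_iff)

lemma adj_diff: "adj (A - B) = adj A - adj B"
  by (simp add: adj_def vec_eq_iff)

lemma adj_scaleR: "adj (c *\<^sub>R A) = c *\<^sub>R adj A"
  by (simp add: adj_def vec_eq_iff)

lemma adj_mat_1 [simp]: "adj (mat 1) = mat 1"
  by (simp add: adj_def vec_eq_iff mat_def)

lemma adj_outer: "adj (outer v w) = outer w v"
  by (simp add: adj_def outer_def vec_eq_iff mult.commute)

lemma adj_sum: "adj (\<Sum>i\<in>I. f i) = (\<Sum>i\<in>I. adj (f i))"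
  by (simp add: adj_def vec_eq_iff)

lemma cinner_adj: "cinner x (A *v y) = cinner (adj A *v x) y"
proof -
  have "cinner x (A *v y) = (\<Sum>k\<in>UNIV. \<Sum>j\<in>UNIV. cnj (x $ k) * A $ k $ j * y $ j)"
    by (simp add: cinner_def matrix_vector_mult_def sum_distrib_left mult.assoc)
  also have "\<dots> = (\<Sum>j\<in>UNIV. \<Sum>k\<in>UNIV. cnj (x $ k) * A $ k $ j * y $ j)"
    by (rule sum.swap)
  also have "\<dots> = cinner (adj A *v x) y"
    by (simp add: cinner_def matrix_vector_mult_def adj_def sum_distrib_left mult_ac)
  finally show ?thesis .
qed

lemma cinner_commute: "cnj (cinner x y) = cinner y x"
  by (simp add: cinner_def mult.commute)

lemma cinner_add_right: "cinner x (y + z) = cinner x y + cinner x z"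
  by (simp add: cinner_def ring_distribs sum.distrib)

lemma cinner_diff_right: "cinner x (y - z) = cinner x y - cinner x z"
  by (simp add: cinner_def ring_distribs sum_subtractf)

lemma cinner_scale_right: "cinner x (c *s y) = c * cinner x y"
  by (simp add: cinner_def sum_distrib_left mult.left_commute)

lemma cinner_scale_left: "cinner (c *s x) y = cnj c * cinner x y"
  by (simp add: cinner_def sum_distrib_left mult.assoc)

lemma cinner_zero_right [simp]: "cinner x 0 = 0"
  by (simp add: cinner_def)

lemma cinner_zero_left [simp]: "cinner 0 x = 0"
  by (simp add: cinner_def)

lemma cinner_sum_right: "cinner x (\<Sum>i\<in>I. f i) = (\<Sum>i\<in>I. cinner x (f i))"
  by (induction I rule: infinite_finite_induct) (simp_all add: cinner_add_right)

lemma cinner_sum_left: "cinner (\<Sum>i\<in>I. f i) x = (\<Sum>i\<in>I. cinner (f i) x)"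
  by (subst cinner_commute [symmetric], subst cinner_sum_right) (simp add: cinner_commute)

lemma Re_cinner: "Re (cinner x y) = x \<bullet> y"
  by (simp add: cinner_def inner_vec_def inner_complex_def)

lemma cinner_self: "cinner x x = complex_of_real ((norm x)\<^sup>2)"
proof -
  have "Im (cinner x x) = 0"
    by (simp add: cinner_def mult.commute)
  then show ?thesis
    by (simp add: complex_eq_iff Re_cinner power2_norm_eq_inner)
qed

lemma smult_of_real: "complex_of_real c *s x = c *\<^sub>R x"
  by (simp add: vec_eq_iff complex_eq_iff)

lemma matrix_vector_mult_scaleR_right: "(A::complex^'n^'m) *v (c *\<^sub>R x) = c *\<^sub>R (A *v x)"
  by (simp add: vec_eq_iff matrix_vector_mult_def scaleR_sum_right)

lemma matrix_vector_mult_scaleR_left: "(c *\<^sub>R (A::complex^'n^'m)) *v x = c *\<^sub>R (A *v x)"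
  by (simp add: vec_eq_iff matrix_vector_mult_def scaleR_sum_right)

lemma outer_matrix_vector_mult: "outer v w *v z = cinner w z *s v"
  by (simp add: vec_eq_iff matrix_vector_mult_def outer_def cinner_def sum_distrib_left sum_distrib_right mult_ac)

lemma sum_matrix_vector_mult: "(\<Sum>i\<in>I. f i) *v z = (\<Sum>i\<in>I. f i *v (z :: complex^'n))"
  by (induction I rule: infinite_finite_induct) (simp_all add: matrix_vector_mult_add_rdistrib)

text \<open>The nested vector type already carries a real inner product, and it is the Frobenius
  one. Traces in the capacity and in the power thus become inner products and norms, and
  multiplication by a matrix is moved across by its adjoint.\<close>

lemma Re_trace_adj: "Re (trace (adj X ** Y)) = X \<bullet> Y"
proof -
  have "Re (trace (adj X ** Y)) = (\<Sum>i\<in>UNIV. \<Sum>k\<in>UNIV. X $ k $ i \<bullet> Y $ k $ i)"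
    by (simp add: trace_def matrix_matrix_mult_def adj_def inner_complex_def)
  also have "\<dots> = X \<bullet> Y"
    by (subst sum.swap) (simp add: inner_vec_def)
  finally show ?thesis .
qed

lemma inner_matrix_left: "(P ** X) \<bullet> Y = X \<bullet> (adj P ** Y)"
  by (simp flip: Re_trace_adj add: adj_mult matrix_mul_assoc)

lemma inner_matrix_right: "(X ** P) \<bullet> Y = X \<bullet> (Y ** adj P)"
proof -
  have "trace (adj P ** (adj X ** Y)) = trace ((adj X ** Y) ** adj P)"
    by (rule trace_mul_sym)
  then show ?thesis
    by (simp flip: Re_trace_adj add: adj_mult matrix_mul_assoc)
qed

lemma matrix_mult_diff_left: "((A::complex^'n^'m) - B) ** D = A ** D - B ** D"
  by (simp add: vec_eq_iff matrix_matrix_mult_def sum_subtractf ring_distribs)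

lemma matrix_mult_diff_right: "(D::complex^'n^'m) ** (A - B) = D ** A - D ** B"
  by (simp add: vec_eq_iff matrix_matrix_mult_def sum_subtractf ring_distribs)

lemma matrix_mult_scaleR_left: "(c *\<^sub>R (A::complex^'n^'m)) ** B = c *\<^sub>R (A ** B)"
  by (simp add: vec_eq_iff matrix_matrix_mult_def scaleR_sum_right)

lemma matrix_mult_scaleR_right: "(A::complex^'n^'m) ** (c *\<^sub>R B) = c *\<^sub>R (A ** B)"
  by (simp add: vec_eq_iff matrix_matrix_mult_def scaleR_sum_right)

lemma matrix_mult_add_left: "((A::complex^'n^'m) + B) ** D = A ** D + B ** D"
  by (simp add: vec_eq_iff matrix_matrix_mult_def sum.distrib ring_distribs)

lemma matrix_mult_zero_left [simp]: "(0::complex^'n^'m) ** A = 0"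
  by (simp add: vec_eq_iff matrix_matrix_mult_def)

lemma matrix_mult_zero_right [simp]: "A ** (0::complex^'n^'m) = 0"
  by (simp add: vec_eq_iff matrix_matrix_mult_def)

lemmas matrix_ring_simps = matrix_mult_diff_left matrix_mult_diff_right
  matrix_add_ldistrib matrix_mult_add_left matrix_mult_scaleR_left matrix_mult_scaleR_right

text \<open>Expanding the standard basis vectors gives the completeness relation
  \<open>comp\<close>, which collapses the double sum to the diagonal. The hypothesis is the
  expansion itself, so numbered bases and bases given as sets are treated alike.\<close>

lemma trace_orthonormal_expansion:
  fixes P :: "complex^'n^'n"
  assumes "finite I" and expand: "\<And>x. x = (\<Sum>i\<in>I. cinner (w i) x *s w i)"
  shows "trace P = (\<Sum>i\<in>I. cinner (w i) (P *v w i))"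
proof -
  have comp: "(\<Sum>i\<in>I. cnj (w i $ k) * w i $ j) = (if j = k then 1 else 0)" for j k
  proof -
    have c: "cinner v (axis k 1) = cnj (v $ k)" for v :: "complex^'n"
      by (simp add: cinner_def axis_def if_distrib cong: if_cong)
    have "axis k 1 $ j = (\<Sum>i\<in>I. cinner (w i) (axis k 1) *s w i) $ j"
      using expand by metis
    from this [symmetric] show ?thesis
      by (simp add: c) (simp add: axis_def)
  qed
  have "(\<Sum>i\<in>I. cinner (w i) (P *v w i)) = (\<Sum>i\<in>I. \<Sum>k\<in>UNIV. \<Sum>j\<in>UNIV. P $ k $ j * (cnj (w i $ k) * w i $ j))"
    by (simp add: cinner_def matrix_vector_mult_def sum_distrib_left algebra_simps)
  also have "\<dots> = (\<Sum>k\<in>UNIV. \<Sum>j\<in>UNIV. \<Sum>i\<in>I. P $ k $ j * (cnj (w i $ k) * w i $ j))"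
    by (subst sum.swap, intro sum.cong refl, rule sum.swap)
  also have "\<dots> = (\<Sum>k\<in>UNIV. \<Sum>j\<in>UNIV. P $ k $ j * (if j = k then 1 else 0))"
    by (simp only: comp sum_distrib_left [symmetric])
  also have "\<dots> = trace P"
    by (simp add: trace_def if_distrib cong: if_cong)
  finally show ?thesis ..
qed

text \<open>The sum \<open>P\<close> of the rank-one projections is a Hermitian idempotent of full
  trace. Its complement is a Hermitian idempotent too, so its squared Frobenius norm equals its
  trace, which is zero.\<close>

lemma orthonormal_card_expansion:
  fixes a :: "nat \<Rightarrow> complex^'n"
  assumes orth: "\<And>i j. i < CARD('n) \<Longrightarrow> j < CARD('n) \<Longrightarrow> cinner (a i) (a j) = (if i = j then 1 else 0)"
  shows "x = (\<Sum>i<CARD('n). cinner (a i) x *s a i)"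
proof -
  define P where "P = (\<Sum>i<CARD('n). outer (a i) (a i))"
  have P: "P *v y = (\<Sum>i<CARD('n). cinner (a i) y *s a i)" for y
    by (simp add: P_def sum_matrix_vector_mult outer_matrix_vector_mult)
  have adjP: "adj P = P"
    by (simp add: P_def adj_sum adj_outer)
  have "P *v (P *v y) = P *v y" for y
  proof -
    have "cinner (a i) (P *v y) = cinner (a i) y" if "i < CARD('n)" for i
      using that by (simp add: P cinner_sum_right cinner_scale_right orth if_distrib cong: if_cong)
    then show ?thesis
      by (subst (1 3) P) simp
  qed
  then have idem: "P ** P = P"
    by (metis matrix_eq matrix_vector_mul_assoc)
  have trace_sum: "trace (\<Sum>i\<in>I. f i) = (\<Sum>i\<in>I. trace (f i))" for I :: "nat set" and f :: "nat \<Rightarrow> complex^'n^'n"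
    by (induction I rule: infinite_finite_induct) (simp_all add: trace_add, simp_all add: trace_def)
  have "trace (outer (a i) (a i)) = 1" if "i < CARD('n)" for i
    using orth [OF that that] by (simp add: trace_def outer_def cinner_def mult.commute)
  then have "trace P = of_nat CARD('n)"
    by (simp add: P_def trace_sum)
  then have "trace (mat 1 - P) = 0"
    by (simp add: trace_sub trace_I)
  moreover have "adj (mat 1 - P) ** (mat 1 - P) = mat 1 - P"
    by (simp add: adj_diff adjP matrix_ring_simps idem)
  ultimately have "(mat 1 - P) \<bullet> (mat 1 - P) = 0"
    by (simp flip: Re_trace_adj)
  then have "P = mat 1"
    by simp
  then show ?thesis
    using P [of x] by simp
qed

lemma Bessel_inequality:
  assumes "finite I" and orth: "\<And>i j. i \<in> I \<Longrightarrow> j \<in> I \<Longrightarrow> cinner (w i) (w j) = (if i = j then 1 else 0)"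
  shows "(\<Sum>i\<in>I. (cmod (cinner (w i) x))\<^sup>2) \<le> (norm x)\<^sup>2"
proof -
  define y where "y = (\<Sum>i\<in>I. cinner (w i) x *s w i)"
  have cm: "cinner (w i) x * cnj (cinner (w i) x) = complex_of_real ((cmod (cinner (w i) x))\<^sup>2)" for i
    by (metis complex_norm_square)
  have "cinner x y = (\<Sum>i\<in>I. cinner (w i) x * cnj (cinner (w i) x))"
    by (simp add: y_def cinner_sum_right cinner_scale_right cinner_commute)
  then have xy: "cinner x y = complex_of_real (\<Sum>i\<in>I. (cmod (cinner (w i) x))\<^sup>2)"
    by (simp only: cm of_real_sum)
  have wy: "cinner (w i) y = cinner (w i) x" if "i \<in> I" for i
    using that \<open>finite I\<close> by (simp add: y_def cinner_sum_right cinner_scale_right orth if_distrib cong: if_cong)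
  have "cinner y y = (\<Sum>i\<in>I. cnj (cinner (w i) x) * cinner (w i) y)"
    by (subst (1) y_def) (simp add: cinner_sum_left cinner_scale_left)
  also have "\<dots> = (\<Sum>i\<in>I. cinner (w i) x * cnj (cinner (w i) x))"
    by (intro sum.cong refl) (simp add: wy mult.commute)
  also have "\<dots> = complex_of_real (\<Sum>i\<in>I. (cmod (cinner (w i) x))\<^sup>2)"
    by (simp only: cm of_real_sum)
  finally have yy: "y \<bullet> y = (\<Sum>i\<in>I. (cmod (cinner (w i) x))\<^sup>2)"
    by (metis Re_cinner Re_complex_of_real)
  have "x \<bullet> y = (\<Sum>i\<in>I. (cmod (cinner (w i) x))\<^sup>2)"
    using xy by (metis Re_cinner Re_complex_of_real)
  moreover have "0 \<le> (x - y) \<bullet> (x - y)"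
    by simp
  ultimately show ?thesis
    using yy by (simp add: inner_diff_left inner_diff_right inner_commute power2_norm_eq_inner)
qed

section \<open>Common eigenbases of commuting Hermitian matrices\<close>

text \<open>A maximizer of the Rayleigh quotient on the unit sphere of \<open>W\<close> is an
  eigenvector. Invariance of \<open>W\<close> is needed because the maximizer is perturbed in the
  direction of its own residual \<open>g x\<close>, which has to stay in \<open>W\<close>.\<close>

lemma hermitian_eigenvector_in_subspace:
  fixes A :: "complex^'n^'n" and W :: "(complex^'n) set"
  assumes herm: "adj A = A" and "closed W" "v \<in> W" "v \<noteq> 0"
    and add: "\<And>x y. x \<in> W \<Longrightarrow> y \<in> W \<Longrightarrow> x + y \<in> W"
    and scale: "\<And>c x. x \<in> W \<Longrightarrow> c *s x \<in> W"
    and inv: "\<And>x. x \<in> W \<Longrightarrow> A *v x \<in> W"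
  obtains x l where "x \<in> W" "norm x = 1" "A *v x = complex_of_real l *s x"
proof -
  define f where "f x = x \<bullet> (A *v x)" for x
  have scaleR: "c *\<^sub>R x \<in> W" if "x \<in> W" for c x
    using scale [OF that, of "complex_of_real c"] by (simp add: smult_of_real)
  have "compact (W \<inter> sphere 0 1)"
    using \<open>closed W\<close> by (simp add: closed_Int_compact)
  moreover have "(1 / norm v) *\<^sub>R v \<in> W \<inter> sphere 0 1"
    using assms scaleR by simp
  moreover have "continuous_on (W \<inter> sphere 0 1) f"
    unfolding f_def
    by (intro continuous_intros bounded_linear.continuous_on [OF matrix_vector_mul_bounded_linear])
  ultimately obtain x where x: "x \<in> W \<inter> sphere 0 1" and max: "\<And>y. y \<in> W \<inter> sphere 0 1 \<Longrightarrow> f y \<le> f x"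
    using continuous_attains_sup [of "W \<inter> sphere 0 1" f] by blast
  define l where "l = f x"
  define g where "g y = A *v y - l *\<^sub>R y" for y
  have le: "y \<bullet> g y \<le> 0" if "y \<in> W" for y
  proof (cases "y = 0")
    case False
    then have "f ((1 / norm y) *\<^sub>R y) \<le> l"
      using that scaleR max unfolding l_def by simp
    then have "f y / (norm y)\<^sup>2 \<le> l"
      by (simp add: f_def matrix_vector_mult_scaleR_right power2_eq_square)
    then have "f y \<le> l * (norm y)\<^sup>2"
      using False by (simp add: pos_divide_le_eq)
    then show ?thesis
      by (simp add: g_def inner_diff_right f_def power2_norm_eq_inner)
  qed (simp add: g_def)
  have gadd: "g (y + z) = g y + g z" for y z
    by (simp add: g_def matrix_vector_right_distrib scaleR_right_distrib)
  have gscale: "g (c *\<^sub>R y) = c *\<^sub>R g y" for c y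
    by (simp add: g_def matrix_vector_mult_scaleR_right scaleR_right_diff_distrib)
  have gsym: "y \<bullet> g z = g y \<bullet> z" for y z
    by (simp add: g_def inner_diff_right inner_diff_left) (metis Re_cinner cinner_adj herm)
  have xg: "x \<bullet> g x = 0"
    using x by (simp add: g_def inner_diff_right l_def f_def flip: power2_norm_eq_inner)
  have "g x = 0"
  proof -
    have gW: "g x \<in> W"
      using x inv [of x] add [of "A *v x" "(- l) *\<^sub>R x"] scaleR [of x "- l"] by (simp add: g_def)
    have bound: "2 * t * (norm (g x))\<^sup>2 + t\<^sup>2 * (g x \<bullet> g (g x)) \<le> 0" for t
    proof -
      have "(x + t *\<^sub>R g x) \<bullet> g (x + t *\<^sub>R g x) \<le> 0"
        using x gW by (intro le add scaleR) auto
      then show ?thesis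
        using xg gsym [of x "g x"]
        by (simp add: gadd gscale inner_add_left inner_add_right power2_eq_square algebra_simps
            flip: power2_norm_eq_inner)
    qed
    define n c where "n = (norm (g x))\<^sup>2" and "c = g x \<bullet> g (g x)"
    have "n \<le> 0"
    proof (rule ccontr)
      assume "\<not> n \<le> 0"
      then have "0 < n" by simp
      \<comment> \<open>So small that the quadratic term is at most half of the linear one:
        \<open>t * \<bar>c\<bar> \<le> n\<close> against \<open>2 * n\<close>. The added 1 excludes
        division by zero.\<close>
      define t where "t = n / (\<bar>c\<bar> + 1)"
      have "0 < t" using \<open>0 < n\<close> by (simp add: t_def)
      have "t * (2 * n + t * c) \<le> 0"
        using bound [of t] by (simp add: n_def c_def power2_eq_square algebra_simps)
      then have "2 * n + t * c \<le> 0"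
        using \<open>0 < t\<close> by (simp add: mult_le_0_iff)
      moreover have "t * \<bar>c\<bar> \<le> n"
        using \<open>0 < n\<close> by (simp add: t_def field_simps)
      moreover have "- (t * \<bar>c\<bar>) \<le> t * c"
        using \<open>0 < t\<close> by (metis abs_ge_minus_self abs_mult abs_of_pos minus_le_iff)
      ultimately show False using \<open>0 < n\<close> by linarith
    qed
    then show ?thesis by (simp add: n_def)
  qed
  then have "A *v x = complex_of_real l *s x"
    by (simp add: g_def smult_of_real)
  then show ?thesis
    using x that by auto
qed

text \<open>An eigenspace of \<open>A\<close> inside \<open>W\<close> is invariant under
  \<open>M\<close> because the two commute, so an eigenvector of \<open>M\<close> can be sought
  within it.\<close>

lemma commuting_hermitian_eigenvector_in_subspace:
  fixes A M :: "complex^'n^'n" and W :: "(complex^'n) set"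
  assumes herm: "adj A = A" "adj M = M" and comm: "A ** M = M ** A"
    and W: "closed W" "v \<in> W" "v \<noteq> 0"
    and add: "\<And>x y. x \<in> W \<Longrightarrow> y \<in> W \<Longrightarrow> x + y \<in> W"
    and scale: "\<And>c x. x \<in> W \<Longrightarrow> c *s x \<in> W"
    and inv: "\<And>x. x \<in> W \<Longrightarrow> A *v x \<in> W" "\<And>x. x \<in> W \<Longrightarrow> M *v x \<in> W"
  obtains x l m where "x \<in> W" "norm x = 1" "A *v x = complex_of_real l *s x" "M *v x = complex_of_real m *s x"
proof -
  obtain y l where y: "y \<in> W" "norm y = 1" "A *v y = complex_of_real l *s y"
    using hermitian_eigenvector_in_subspace [OF herm(1) W add scale inv(1)] by blast
  define E where "E = W \<inter> {x. A *v x = complex_of_real l *s x}"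
  have E1: "closed E"
    unfolding E_def smult_of_real
    by (intro closed_Int W closed_Collect_eq continuous_intros bounded_linear.continuous_on [OF matrix_vector_mul_bounded_linear])
  have E2: "y \<in> E" "y \<noteq> 0"
    using y by (auto simp: E_def)
  have E3: "x + z \<in> E" if "x \<in> E" "z \<in> E" for x z
    using that add by (simp add: E_def matrix_vector_right_distrib vector_add_ldistrib)
  have E4: "c *s x \<in> E" if "x \<in> E" for c x
    using that scale by (simp add: E_def add: vector_scalar_commute vector_smult_assoc mult.commute)
  have E5: "M *v x \<in> E" if "x \<in> E" for x
  proof -
    have "A *v (M *v x) = M *v (A *v x)"
      by (simp add: matrix_vector_mul_assoc comm)
    then show ?thesis
      using that inv(2) by (simp add: E_def vector_scalar_commute)
  qed
  obtain x m where "x \<in> E" "norm x = 1" "M *v x = complex_of_real m *s x"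
    using hermitian_eigenvector_in_subspace [OF herm(2) E1 E2 E3 E4 E5] by blast
  then show ?thesis
    using that by (auto simp: E_def)
qed

text \<open>A family rather than a set of vectors, so that it fits the numbered eigenvectors
  \<open>a\<close> and \<open>b\<close> as well as an eigenbasis known only as a set, which is
  indexed by itself.\<close>

definition orthonormal_family :: "'i set \<Rightarrow> ('i \<Rightarrow> complex^'n) \<Rightarrow> bool" where
  "orthonormal_family I w \<longleftrightarrow> (\<forall>i\<in>I. \<forall>j\<in>I. cinner (w i) (w j) = (if i = j then 1 else 0))"

lemma orthonormal_familyD:
  "orthonormal_family I w \<Longrightarrow> i \<in> I \<Longrightarrow> j \<in> I \<Longrightarrow> cinner (w i) (w j) = (if i = j then 1 else 0)"
  by (simp add: orthonormal_family_def)

lemma orthonormal_family_independent: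
  fixes w :: "'i \<Rightarrow> complex^'n"
  assumes "orthonormal_family I w"
  shows "inj_on w I" "vec.independent (w ` I)"
proof -
  note orth = orthonormal_familyD [OF assms]
  show inj: "inj_on w I"
    by (rule inj_onI) (metis orth zero_neq_one)
  show "vec.independent (w ` I)"
  proof (unfold vec.independent_explicit_module, intro allI impI)
    fix T u v
    assume "finite T" "T \<subseteq> w ` I" and sum0: "(\<Sum>v\<in>T. u v *s v) = 0" and "v \<in> T"
    obtain i where i: "i \<in> I" "v = w i"
      using \<open>v \<in> T\<close> \<open>T \<subseteq> w ` I\<close> by blast
    have "0 = (\<Sum>z\<in>T. u z * cinner v z)"
      using arg_cong [OF sum0, of "cinner v"] by (simp add: cinner_sum_right cinner_scale_right)
    also have "\<dots> = (\<Sum>z\<in>T. if z = v then u z else 0)"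
    proof (intro sum.cong refl)
      fix z assume "z \<in> T"
      then obtain j where "j \<in> I" "z = w j"
        using \<open>T \<subseteq> w ` I\<close> by blast
      then show "u z * cinner v z = (if z = v then u z else 0)"
        using i orth [of i j] inj by (auto simp: inj_on_def)
    qed
    also have "\<dots> = u v"
      using \<open>finite T\<close> \<open>v \<in> T\<close> by simp
    finally show "u v = 0" by simp
  qed
qed

lemma orthonormal_family_finite_card:
  fixes w :: "'i \<Rightarrow> complex^'n"
  assumes "orthonormal_family I w"
  shows "finite I" "card I \<le> CARD('n)"
proof -
  note ind = orthonormal_family_independent [OF assms]
  have "finite (w ` I)"
    using ind(2) vec.finiteI_independent by blast
  then show "finite I"
    using ind(1) finite_image_iff by blast
  have "card (w ` I) = vec.dim (w ` I)"
    using ind(2) by (simp add: vec.dim_eq_card_independent)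
  also have "\<dots> \<le> vec.dim (UNIV :: (complex^'n) set)"
    by (rule vec.dim_subset) simp
  finally have "card (w ` I) \<le> vec.dim (UNIV :: (complex^'n) set)" .
  then show "card I \<le> CARD('n)"
    using ind(1) by (simp only: card_image vec_dim_card)
qed

text \<open>An orthonormal set of common eigenvectors of largest cardinality is complete: its
  orthogonal complement is invariant under both Hermitian matrices, and if it were nonzero it would
  contain one more common eigenvector.\<close>

lemma commuting_hermitian_eigenbasis:
  fixes A M :: "complex^'n^'n"
  assumes herm: "adj A = A" "adj M = M" and comm: "A ** M = M ** A"
  obtains S al m where "finite S" "orthonormal_family S (\<lambda>w. w)"
    "\<And>w. w \<in> S \<Longrightarrow> A *v w = complex_of_real (al w) *s w"
    "\<And>w. w \<in> S \<Longrightarrow> M *v w = complex_of_real (m w) *s w"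
    "\<And>x. x = (\<Sum>w\<in>S. cinner w x *s w)"
proof -
  define ok where "ok S \<longleftrightarrow> orthonormal_family S (\<lambda>w. w) \<and>
    (\<forall>w\<in>S. (\<exists>l. A *v w = complex_of_real l *s w) \<and> (\<exists>l. M *v w = complex_of_real l *s w))" for S
  have "ok {}"
    by (simp add: ok_def orthonormal_family_def)
  moreover have "\<forall>S. ok S \<longrightarrow> card S \<le> CARD('n)"
    using orthonormal_family_finite_card(2) unfolding ok_def by blast
  ultimately obtain S where S: "ok S" and maxS: "\<And>T. ok T \<Longrightarrow> card T \<le> card S"
    using ex_has_greatest_nat [of ok "{}" card "Suc CARD('n)"] by (metis le_imp_less_Suc)
  have orth: "orthonormal_family S (\<lambda>w. w)"
    using S by (simp add: ok_def)
  note finS = orthonormal_family_finite_card(1) [OF orth]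
  have "\<forall>w\<in>S. \<exists>l. A *v w = complex_of_real l *s w" "\<forall>w\<in>S. \<exists>l. M *v w = complex_of_real l *s w"
    using S by (auto simp: ok_def)
  then obtain al m where al: "\<And>w. w \<in> S \<Longrightarrow> A *v w = complex_of_real (al w) *s w"
    and m: "\<And>w. w \<in> S \<Longrightarrow> M *v w = complex_of_real (m w) *s w"
    by metis
  define W where "W = {x. \<forall>w\<in>S. cinner w x = 0}"
  have W0: "x = 0" if xW: "x \<in> W" for x
  proof (rule ccontr)
    assume "x \<noteq> 0"
    have "W = (\<Inter>w\<in>S. {x. cinner w x = 0})"
      by (auto simp: W_def)
    then have cW: "closed W"
      by (simp only:) (intro closed_INT ballI closed_Collect_eq continuous_intros, simp add: cinner_def, intro continuous_intros)
    have inv: "A *v y \<in> W" "M *v y \<in> W" if "y \<in> W" for y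
      using that by (auto simp: W_def cinner_adj herm al m cinner_scale_left)
    have add: "y + z \<in> W" if "y \<in> W" "z \<in> W" for y z
      using that by (auto simp: W_def cinner_add_right)
    have scale: "c *s y \<in> W" if "y \<in> W" for c y
      using that by (auto simp: W_def cinner_scale_right)
    obtain y l l' where y: "y \<in> W" "norm y = 1" "A *v y = complex_of_real l *s y" "M *v y = complex_of_real l' *s y"
      using commuting_hermitian_eigenvector_in_subspace [OF herm comm cW xW \<open>x \<noteq> 0\<close> add scale inv]
      by blast
    have yy: "cinner y y = 1"
      using y by (simp add: cinner_self)
    have "cinner w y = 0" "cinner y w = 0" if "w \<in> S" for w
      using that y(1) cinner_commute [of w y] by (auto simp: W_def)
    then have "ok (insert y S)" and "y \<notin> S"
      using S yy y(3,4) by (auto simp: ok_def orthonormal_family_def)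
    then show False
      using maxS [of "insert y S"] finS by simp
  qed
  have "x = (\<Sum>w\<in>S. cinner w x *s w)" for x
  proof -
    have "x - (\<Sum>w\<in>S. cinner w x *s w) \<in> W"
      using finS
      by (auto simp: W_def cinner_diff_right cinner_sum_right cinner_scale_right orthonormal_familyD [OF orth]
          if_distrib cong: if_cong)
    from W0 [OF this] show ?thesis by simp
  qed
  then show ?thesis
    using that finS orth al m by blast
qed

text \<open>Inside an eigenspace the \<open>y w\<close> may be arbitrary combinations of the
  \<open>b i\<close>, so vectors cannot be identified, only counted. For each value \<open>t\<close>
  the weights |<b i, y w>|^2 are summed over both fibres: every \<open>y w\<close> contributes
  exactly 1, and every \<open>b i\<close> receives at most 1 by Bessel. Each fibre of
  \<open>mu'\<close> is thus no larger than the fibre of \<open>mu\<close> over the same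
  value.\<close>

lemma orthonormal_eigenvalue_matching:
  fixes b :: "'i \<Rightarrow> complex^'n" and y :: "'j \<Rightarrow> complex^'n" and mu :: "'i \<Rightarrow> real"
  assumes y: "orthonormal_family J y" and b: "orthonormal_family I b"
    and expand: "\<And>w. w \<in> J \<Longrightarrow> y w = (\<Sum>i\<in>I. cinner (b i) (y w) *s b i)"
    and eig: "\<And>w i. w \<in> J \<Longrightarrow> i \<in> I \<Longrightarrow> cinner (b i) (y w) \<noteq> 0 \<Longrightarrow> mu i = mu' w"
  obtains s where "inj_on s J" "s ` J \<subseteq> I" "\<And>w. w \<in> J \<Longrightarrow> mu (s w) = mu' w"
proof -
  have fin: "finite I" "finite J"
    using orthonormal_family_finite_card y b by blast+
  have cm: "cinner u v * cinner v u = complex_of_real ((cmod (cinner u v))\<^sup>2)" for u v :: "complex^'n"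
    by (metis complex_norm_square cinner_commute)
  have fibre: "card {w\<in>J. mu' w = t} \<le> card {i\<in>I. mu i = t}" for t
  proof -
    let ?J = "{w\<in>J. mu' w = t}" and ?I = "{i\<in>I. mu i = t}"
    have one: "(\<Sum>i\<in>?I. (cmod (cinner (b i) (y w)))\<^sup>2) = 1" if "w \<in> ?J" for w
    proof -
      have w: "w \<in> J" "mu' w = t" using that by auto
      have "complex_of_real (\<Sum>i\<in>?I. (cmod (cinner (b i) (y w)))\<^sup>2)
          = complex_of_real (\<Sum>i\<in>I. (cmod (cinner (b i) (y w)))\<^sup>2)"
        using fin eig w by (subst sum.mono_neutral_left [of I ?I]) auto
      also have "\<dots> = cinner (y w) (\<Sum>i\<in>I. cinner (b i) (y w) *s b i)"
        by (simp add: cinner_sum_right cinner_scale_right cm flip: of_real_power)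
      also have "\<dots> = 1"
        using expand [OF w(1)] orthonormal_familyD [OF y w(1) w(1)] by simp
      finally show ?thesis
        by (metis of_real_eq_1_iff)
    qed
    have "real (card ?J) = (\<Sum>w\<in>?J. \<Sum>i\<in>?I. (cmod (cinner (b i) (y w)))\<^sup>2)"
      using one by simp
    also have "\<dots> = (\<Sum>i\<in>?I. \<Sum>w\<in>?J. (cmod (cinner (b i) (y w)))\<^sup>2)"
      by (rule sum.swap)
    also have "\<dots> \<le> (\<Sum>i\<in>?I. 1)"
    proof (rule sum_mono)
      fix i assume i: "i \<in> ?I"
      have "(\<Sum>w\<in>?J. (cmod (cinner (b i) (y w)))\<^sup>2) = (\<Sum>w\<in>?J. (cmod (cinner (y w) (b i)))\<^sup>2)"
        by (metis cinner_commute complex_mod_cnj)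
      also have "\<dots> \<le> (norm (b i))\<^sup>2"
        using fin y by (intro Bessel_inequality) (auto simp: orthonormal_family_def)
      also have "(norm (b i))\<^sup>2 = 1"
        using i orthonormal_familyD [OF b, of i i] cinner_self [of "b i"] by simp (metis of_real_eq_1_iff of_real_power)
      finally show "(\<Sum>w\<in>?J. (cmod (cinner (b i) (y w)))\<^sup>2) \<le> 1" .
    qed
    finally show ?thesis by simp
  qed
  have ex: "\<exists>f. f ` {w\<in>J. mu' w = t} \<subseteq> {i\<in>I. mu i = t} \<and> inj_on f {w\<in>J. mu' w = t}" for t
    using fin fibre [of t] by (intro card_le_inj) auto
  obtain f where f': "\<forall>t. f t ` {w\<in>J. mu' w = t} \<subseteq> {i\<in>I. mu i = t} \<and> inj_on (f t) {w\<in>J. mu' w = t}"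
    using choice [OF allI [OF ex]] by (rule exE)
  have f: "f t ` {w\<in>J. mu' w = t} \<subseteq> {i\<in>I. mu i = t}" and finj: "inj_on (f t) {w\<in>J. mu' w = t}" for t
    using spec [OF f', of t] by (rule conjunct1, rule conjunct2)
  \<comment> \<open>Glues the fibrewise injections; different fibres cannot collide, since
    \<open>mu (s w)\<close> recovers the fibre.\<close>
  define s where "s w = f (mu' w) w" for w
  have sI: "s w \<in> I" "mu (s w) = mu' w" if "w \<in> J" for w
    using f [of "mu' w"] that by (auto simp: s_def)
  have "inj_on s J"
  proof (rule inj_onI)
    fix v w assume vw: "v \<in> J" "w \<in> J" "s v = s w"
    then have "mu' v = mu' w" using sI by metis
    then show "v = w"
      using finj [of "mu' v"] vw by (auto simp: s_def inj_on_def)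
  qed
  then show ?thesis
    using that sI by blast
qed

section \<open>Rearrangement\<close>

text \<open>Exchange argument from the top: the largest value of the injection is moved to the last
  row, which the Monge inequality permits, and is then lowered to the diagonal by monotonicity,
  since an injection on \<open>q + 1\<close> rows attains a value at least \<open>q\<close>.\<close>

lemma sum_Monge_injection:
  fixes f :: "nat \<Rightarrow> nat \<Rightarrow> real"
  assumes monge: "\<And>i i' j j'. i < i' \<Longrightarrow> i' < q \<Longrightarrow> j < j' \<Longrightarrow> j' < n \<Longrightarrow> f i j + f i' j' \<le> f i j' + f i' j"
    and mono: "\<And>i j j'. i < q \<Longrightarrow> j \<le> j' \<Longrightarrow> j' < n \<Longrightarrow> f i j \<le> f i j'"
    and inj: "inj_on s {..<q}" and range: "s ` {..<q} \<subseteq> {..<n}"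
  shows "(\<Sum>i<q. f i i) \<le> (\<Sum>i<q. f i (s i))"
  using assms
proof (induction q arbitrary: s)
  case (Suc q)
  define m where "m = Max (s ` {..<Suc q})"
  have "m \<in> s ` {..<Suc q}"
    unfolding m_def by (rule Max_in) auto
  then obtain i where i: "i < Suc q" "s i = m" by auto
  have le_m: "s j \<le> m" if "j < Suc q" for j
    using that unfolding m_def by (intro Max_ge) auto
  have "m < n" using Suc.prems(4) i by auto
  have "Suc q = card (s ` {..<Suc q})"
    using card_image [OF Suc.prems(3)] by simp
  also have "\<dots> \<le> card {..m}"
    using le_m by (intro card_mono) auto
  finally have "q \<le> m" by simp
  \<comment> \<open>\<open>t\<close> swaps the values of \<open>s\<close> at \<open>i\<close> and
    \<open>q\<close>. With the maximum parked at \<open>q\<close>, its restriction to the smaller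
    rows is an injection fit for the induction hypothesis.\<close>
  define t where "t = s(i := s q, q := m)"
  have t_q: "t q = m" by (simp add: t_def)
  have inj_t: "inj_on t {..<Suc q}"
    using Suc.prems(3) i unfolding t_def inj_on_def by auto
  have "t ` {..<Suc q} \<subseteq> {..<n}"
    using Suc.prems(4) i \<open>m < n\<close> unfolding t_def by auto
  then have "(\<Sum>j<q. f j j) \<le> (\<Sum>j<q. f j (t j))"
    using inj_t by (intro Suc.IH Suc.prems) (auto simp: inj_on_def image_subset_iff)
  moreover have "f q q \<le> f q m"
    using \<open>q \<le> m\<close> \<open>m < n\<close> by (intro Suc.prems(2)) auto
  ultimately have "(\<Sum>j<Suc q. f j j) \<le> (\<Sum>j<Suc q. f j (t j))"
    using t_q by simp
  also have "\<dots> \<le> (\<Sum>j<Suc q. f j (s j))"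
  proof (cases "i = q")
    case True
    then have "t = s" using i by (auto simp: t_def)
    then show ?thesis by simp
  next
    case False
    then have "i < q" using i by simp
    have "s q \<noteq> m"
      using inj_onD [OF Suc.prems(3), of q i] i False by auto
    then have "f i (s q) + f q m \<le> f i m + f q (s q)"
      using \<open>i < q\<close> \<open>m < n\<close> le_m [of q] by (intro Suc.prems(1)) auto
    moreover have "(\<Sum>j<q. f j (t j)) = f i (t i) + (\<Sum>j\<in>{..<q} - {i}. f j (t j))"
      "(\<Sum>j<q. f j (s j)) = f i (s i) + (\<Sum>j\<in>{..<q} - {i}. f j (s j))"
      using \<open>i < q\<close> by (auto intro: sum.remove)
    moreover have "(\<Sum>j\<in>{..<q} - {i}. f j (t j)) = (\<Sum>j\<in>{..<q} - {i}. f j (s j))"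
      by (intro sum.cong) (auto simp: t_def)
    ultimately show ?thesis
      using i False by (simp add: t_def)
  qed
  finally show ?case .
qed simp

lemma enumerate_decreasing:
  fixes p :: "'i \<Rightarrow> real"
  assumes "finite J"
  obtains e where "bij_betw e {..<card J} J" "\<And>i j. i \<le> j \<Longrightarrow> j < card J \<Longrightarrow> p (e j) \<le> p (e i)"
proof -
  obtain ys where ys: "set ys = J" "distinct ys"
    using finite_distinct_list [OF assms] by blast
  define xs where "xs = sort_key (\<lambda>x. - p x) ys"
  have xs: "set xs = J" "distinct xs" "length xs = card J" "sorted (map (\<lambda>x. - p x) xs)"
    using ys distinct_card [of ys] by (auto simp: xs_def)
  have "bij_betw ((!) xs) {..<card J} J"
    using bij_betw_nth [OF xs(2)] xs by simp
  moreover have "p (xs ! j) \<le> p (xs ! i)" if "i \<le> j" "j < card J" for i j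
    using sorted_nth_mono [OF xs(4) that(1)] that xs(3) by simp
  ultimately show ?thesis using that by blast
qed

text \<open>The gain \<open>a x / (1 + x)\<close> of an eigenmode in terms of its whitened variable \<open>p = (1 + k a) x\<close>,
  whose cost \<open>p / \<mu>\<close> no longer depends on \<open>a\<close>. In terms of \<open>x\<close> the cost
  \<open>(1 + k a) x / \<mu>\<close> and the gain favour opposite pairings of \<open>a\<close> and \<open>x\<close>.\<close>

definition relay_gain :: "real \<Rightarrow> real \<Rightarrow> real \<Rightarrow> real" where
  "relay_gain k a p = a * p / (1 + k * a + p)"

lemma relay_gain_mono:
  assumes "0 \<le> k" "0 \<le> p" "0 \<le> a'" "a' \<le> a"
  shows "relay_gain k a' p \<le> relay_gain k a p"
proof -
  have "k * a' \<le> k * a" "0 \<le> k * a'"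
    using assms by (auto intro: mult_left_mono)
  then have "a' * (1 + k * a + p) \<le> a * (1 + k * a' + p)"
    using assms mult_right_mono [of a' a "1 + p"] by (simp add: algebra_simps)
  then have "(a' * p) * (1 + k * a + p) \<le> (a * p) * (1 + k * a' + p)"
    using mult_right_mono [OF _ \<open>0 \<le> p\<close>] by (metis mult.commute mult.left_commute)
  moreover have "0 < 1 + k * a' + p" "0 < 1 + k * a + p"
    using assms \<open>0 \<le> k * a'\<close> \<open>k * a' \<le> k * a\<close> by linarith+
  ultimately show ?thesis
    by (simp only: relay_gain_def pos_divide_le_eq pos_le_divide_eq times_divide_eq_left)
qed

text \<open>The difference in \<open>a\<close> factors as \<open>a - a'\<close> times r / (u + r)
  times (1 + r) / (u' + r). Both fractions increase with r because u and u' are at least 1.\<close>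

lemma relay_gain_supermodular:
  assumes "0 \<le> k" "0 \<le> p'" "p' \<le> p" "0 \<le> a'" "a' \<le> a"
  shows "relay_gain k a' p + relay_gain k a p' \<le> relay_gain k a p + relay_gain k a' p'"
proof -
  define u where "u = 1 + k * a"
  define u' where "u' = 1 + k * a'"
  have u: "1 \<le> u" "1 \<le> u'"
    using assms by (auto simp: u_def u'_def)
  have diff: "relay_gain k a r - relay_gain k a' r = (a - a') * ((r / (u + r)) * ((1 + r) / (u' + r)))"
    if "0 \<le> r" for r
  proof -
    have "relay_gain k a r - relay_gain k a' r = (a * r * (u' + r) - a' * r * (u + r)) / ((u + r) * (u' + r))"
      using that u by (simp add: relay_gain_def divide_simps flip: u_def u'_def)
    \<comment> \<open>The mixed terms \<open>k * a * a'\<close> cancel, which is what lets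
      \<open>a - a'\<close> factor out.\<close>
    also have "a * r * (u' + r) - a' * r * (u + r) = (a - a') * (r * (1 + r))"
      by (simp add: u_def u'_def algebra_simps)
    finally show ?thesis by simp
  qed
  have incr: "(c + p') / (v + p') \<le> (c + p) / (v + p)" if "0 \<le> c" "c \<le> v" "1 \<le> v" for c v :: real
  proof -
    have "c * (p - p') \<le> v * (p - p')"
      using assms that by (intro mult_right_mono) auto
    then have "(c + p') * (v + p) \<le> (c + p) * (v + p')"
      by (simp add: algebra_simps)
    then show ?thesis
      using assms that by (simp add: frac_le_eq divide_simps)
  qed
  have "(p' / (u + p')) * ((1 + p') / (u' + p')) \<le> (p / (u + p)) * ((1 + p) / (u' + p))"
    using incr [of 0 u] incr [of 1 u'] u assms by (intro mult_mono) auto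
  then have "(a - a') * ((p' / (u + p')) * ((1 + p') / (u' + p'))) \<le> (a - a') * ((p / (u + p)) * ((1 + p) / (u' + p)))"
    using assms by (intro mult_left_mono) auto
  then show ?thesis
    using diff [of p] diff [of p'] assms by linarith
qed

text \<open>The cost involves only the pairing of \<open>p\<close> with \<open>mu\<close>, and the
  gain only the pairing of \<open>p\<close> with \<open>alpha\<close>. With the modes listed by
  decreasing \<open>p\<close>, each of the two injections can be replaced by the identity without
  regard to the other.\<close>

lemma relay_gain_rearrangement:
  fixes alpha mu :: "nat \<Rightarrow> real" and p :: "'i \<Rightarrow> real"
  assumes "finite J" and p: "\<And>w. w \<in> J \<Longrightarrow> 0 \<le> p w" and "0 \<le> k"
    and alpha: "\<And>i. i < s \<Longrightarrow> 0 \<le> alpha i" "\<And>i j. i \<le> j \<Longrightarrow> j < s \<Longrightarrow> alpha j \<le> alpha i"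
    and mu: "\<And>i. i < n \<Longrightarrow> 0 < mu i" "\<And>i j. i \<le> j \<Longrightarrow> j < n \<Longrightarrow> mu j \<le> mu i"
    and f: "inj_on f J" "f ` J \<subseteq> {..<s}" and g: "inj_on g J" "g ` J \<subseteq> {..<n}"
  obtains q p' where "q \<le> s" "q \<le> n" "\<And>i. i < q \<Longrightarrow> 0 \<le> p' i"
    "(\<Sum>i<q. p' i / mu i) \<le> (\<Sum>w\<in>J. p w / mu (g w))"
    "(\<Sum>w\<in>J. relay_gain k (alpha (f w)) (p w)) \<le> (\<Sum>i<q. relay_gain k (alpha i) (p' i))"
proof -
  obtain e where e: "bij_betw e {..<card J} J"
    and decr: "\<And>i j. i \<le> j \<Longrightarrow> j < card J \<Longrightarrow> p (e j) \<le> p (e i)"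
    using enumerate_decreasing [OF \<open>finite J\<close>] by metis
  have eJ: "e i \<in> J" if "i < card J" for i
    using e that by (auto simp: bij_betw_def)
  have qs: "card J \<le> s" "card J \<le> n"
    using card_inj_on_le [OF f] card_inj_on_le [OF g] by auto
  have inj: "inj_on (f \<circ> e) {..<card J}" "inj_on (g \<circ> e) {..<card J}"
    using e f(1) g(1) by (auto simp: bij_betw_def intro!: comp_inj_on)
  have range: "(f \<circ> e) ` {..<card J} \<subseteq> {..<s}" "(g \<circ> e) ` {..<card J} \<subseteq> {..<n}"
    using eJ f(2) g(2) by auto
  have "(\<Sum>i<card J. p (e i) / mu i) \<le> (\<Sum>i<card J. p (e i) / mu ((g \<circ> e) i))"
  proof (rule sum_Monge_injection [where n = n, OF _ _ inj(2) range(2)])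
    fix i i' j j' assume *: "i < i'" "i' < card J" "j < j'" "j' < n"
    have "1 / mu j \<le> 1 / mu j'"
      using mu * by (intro divide_left_mono) (auto intro!: mult_pos_pos)
    then have "0 \<le> (p (e i) - p (e i')) * (1 / mu j' - 1 / mu j)"
      using decr [of i i'] * by (intro mult_nonneg_nonneg) auto
    then show "p (e i) / mu j + p (e i') / mu j' \<le> p (e i) / mu j' + p (e i') / mu j"
      by (simp add: algebra_simps)
  next
    fix i j j' assume *: "i < card J" "j \<le> j'" "j' < n"
    then show "p (e i) / mu j \<le> p (e i) / mu j'"
      using mu p eJ by (intro divide_left_mono) (auto intro!: mult_pos_pos)
  qed
  also have "\<dots> = (\<Sum>w\<in>J. p w / mu (g w))"
    using sum.reindex_bij_betw [OF e] by simp
  finally have 1: "(\<Sum>i<card J. p (e i) / mu i) \<le> (\<Sum>w\<in>J. p w / mu (g w))" .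
  \<comment> \<open>Negated, because the injection lemma bounds sums from below: supermodularity of
    the gain is the Monge condition for its negative.\<close>
  have "(\<Sum>i<card J. - relay_gain k (alpha i) (p (e i))) \<le> (\<Sum>i<card J. - relay_gain k (alpha ((f \<circ> e) i)) (p (e i)))"
  proof (rule sum_Monge_injection [where n = s, OF _ _ inj(1) range(1)])
    fix i i' j j' assume *: "i < i'" "i' < card J" "j < j'" "j' < s"
    have "relay_gain k (alpha j') (p (e i)) + relay_gain k (alpha j) (p (e i'))
        \<le> relay_gain k (alpha j) (p (e i)) + relay_gain k (alpha j') (p (e i'))"
      using * p eJ decr alpha \<open>0 \<le> k\<close> by (intro relay_gain_supermodular) auto
    then show "- relay_gain k (alpha j) (p (e i)) + - relay_gain k (alpha j') (p (e i'))
        \<le> - relay_gain k (alpha j') (p (e i)) + - relay_gain k (alpha j) (p (e i'))"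
      by simp
  next
    fix i j j' assume *: "i < card J" "j \<le> j'" "j' < s"
    then show "- relay_gain k (alpha j) (p (e i)) \<le> - relay_gain k (alpha j') (p (e i))"
      using alpha p eJ \<open>0 \<le> k\<close> by (simp add: relay_gain_mono)
  qed
  also have "\<dots> = - (\<Sum>w\<in>J. relay_gain k (alpha (f w)) (p w))"
    using sum.reindex_bij_betw [OF e, of "\<lambda>w. relay_gain k (alpha (f w)) (p w)"] by (simp add: sum_negf)
  finally have 2: "(\<Sum>w\<in>J. relay_gain k (alpha (f w)) (p w)) \<le> (\<Sum>i<card J. relay_gain k (alpha i) (p (e i)))"
    by (simp add: sum_negf)
  show ?thesis
    using that [OF qs _ 1 2] p eJ by blast
qed

section \<open>The MMSE resolvent\<close>

lemma inner_adj_adj: "adj X \<bullet> adj Y = X \<bullet> Y"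
  by (simp flip: Re_trace_adj) (metis Re_trace_adj adj_adj inner_commute trace_mul_sym)

text \<open>The error covariance of linear estimation through the channel \<open>F\<close> with unit
  signal and noise covariance. Taking \<open>F\<close> as argument, rather than its Gram matrix,
  makes invertibility automatic.\<close>

definition resolvent :: "complex^'s^'r \<Rightarrow> complex^'s^'s" where
  "resolvent F = matrix_inv (mat 1 + adj F ** F)"

lemma invertible_one_plus_gram: "invertible (mat 1 + adj F ** (F :: complex^'s^'r))"
proof -
  have "x = 0" if "(mat 1 + adj F ** F) *v x = 0" for x
  proof -
    have "x \<bullet> ((mat 1 + adj F ** F) *v x) = x \<bullet> x + (F *v x) \<bullet> (F *v x)"
      by (simp add: matrix_vector_mult_add_rdistrib inner_add_right flip: matrix_vector_mul_assoc)
        (metis Re_cinner cinner_adj adj_adj)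
    then have "x \<bullet> x + (F *v x) \<bullet> (F *v x) = 0"
      using that by simp
    then show ?thesis
      using inner_ge_zero [of "F *v x"] inner_ge_zero [of x] by (metis add_nonneg_eq_0_iff inner_eq_zero_iff)
  qed
  then show ?thesis
    unfolding invertible_left_inverse matrix_left_invertible_ker by blast
qed

lemma
  shows resolvent_right_inverse: "(mat 1 + adj F ** F) ** resolvent F = mat 1"
    and resolvent_left_inverse: "resolvent F ** (mat 1 + adj F ** F) = mat 1"
proof -
  have ex: "\<exists>A'. (mat 1 + adj F ** F) ** A' = mat 1 \<and> A' ** (mat 1 + adj F ** F) = mat 1"
    using invertible_one_plus_gram [of F] by (simp add: invertible_def)
  show "(mat 1 + adj F ** F) ** resolvent F = mat 1" "resolvent F ** (mat 1 + adj F ** F) = mat 1"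
    using someI_ex [OF ex] by (auto simp: resolvent_def matrix_inv_def)
qed

lemma resolvent_unique:
  assumes "(mat 1 + adj F ** F) ** Z = mat 1"
  shows "Z = resolvent F"
proof -
  have "Z = (resolvent F ** (mat 1 + adj F ** F)) ** Z"
    by (simp add: resolvent_left_inverse)
  also have "\<dots> = resolvent F"
    by (simp only: matrix_mul_assoc [symmetric] assms matrix_mul_rid)
  finally show ?thesis .
qed

lemma adj_resolvent: "adj (resolvent F) = resolvent F"
proof (rule resolvent_unique)
  have "adj (resolvent F ** (mat 1 + adj F ** F)) = mat 1"
    by (simp add: resolvent_left_inverse)
  then show "(mat 1 + adj F ** F) ** adj (resolvent F) = mat 1"
    by (simp add: adj_mult adj_add)
qed

lemma
  shows gram_resolvent: "adj F ** F ** resolvent F = mat 1 - resolvent F"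
    and resolvent_gram: "resolvent F ** adj F ** F = mat 1 - resolvent F"
proof -
  have "resolvent F + adj F ** F ** resolvent F = mat 1" "resolvent F + resolvent F ** adj F ** F = mat 1"
    using resolvent_right_inverse [of F] resolvent_left_inverse [of F]
    by (simp_all add: matrix_ring_simps matrix_mul_assoc)
  then show "adj F ** F ** resolvent F = mat 1 - resolvent F" "resolvent F ** adj F ** F = mat 1 - resolvent F"
    by (metis add_diff_cancel_left')+
qed

text \<open>Multiplying out shows that I - F^H T F, with T the inverse on the receive side, is a
  right inverse of I + F^H F. This trades the inverse in the capacity formula for the resolvent on
  the relay input side.\<close>

lemma push_through:
  "adj F ** matrix_inv (mat 1 + F ** adj F) ** F = mat 1 - resolvent F"
proof -
  define T where "T = matrix_inv (mat 1 + F ** adj F)"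
  have T: "(mat 1 + F ** adj F) ** T = mat 1"
    using resolvent_right_inverse [of "adj F"] by (simp add: T_def resolvent_def)
  have "adj F ** T ** F + adj F ** F ** adj F ** T ** F = adj F ** ((mat 1 + F ** adj F) ** T) ** F"
    by (simp add: matrix_ring_simps matrix_mul_assoc)
  then have "adj F ** T ** F + adj F ** F ** adj F ** T ** F = adj F ** F"
    by (simp add: T)
  then have "(mat 1 + adj F ** F) ** (mat 1 - adj F ** T ** F) = mat 1"
    by (simp add: matrix_ring_simps matrix_mul_assoc algebra_simps)
  then show ?thesis
    by (subst resolvent_unique [symmetric]) (auto simp: T_def)
qed

lemma one_minus_resolvent_nonneg: "0 \<le> X \<bullet> ((mat 1 - resolvent F) ** X)"
proof -
  define G M U where "G = resolvent F" and "M = adj F ** F" and "U = G ** X"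
  \<comment> \<open>Inserting the identity as G (I + M) gives I - G = G (M + M^2) G, a sum of two
    manifestly nonnegative forms.\<close>
  have "mat 1 - G = G ** (mat 1 + M) ** (M ** G)"
    using resolvent_left_inverse [of F] gram_resolvent [of F] by (simp add: G_def M_def)
  then have "X \<bullet> ((mat 1 - G) ** X) = X \<bullet> (adj G ** ((mat 1 + M) ** (M ** U)))"
    by (simp add: U_def matrix_mul_assoc G_def adj_resolvent)
  also have "\<dots> = U \<bullet> (M ** U) + U \<bullet> (M ** (M ** U))"
    by (simp add: U_def matrix_ring_simps inner_add_right flip: inner_matrix_left)
  also have "U \<bullet> (M ** U) = (F ** U) \<bullet> (F ** U)"
    by (simp add: inner_matrix_left M_def matrix_mul_assoc)
  also have "U \<bullet> (M ** (M ** U)) = (M ** U) \<bullet> (M ** U)"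
    using inner_matrix_left [of M U "M ** U"] by (simp add: M_def adj_mult)
  finally show ?thesis
    unfolding G_def by simp
qed

text \<open>Completing the square around the optimal estimator \<open>U0\<close>: the excess is |F^H
  D|^2 + |D|^2 with D = U - U0. For fixed \<open>U\<close> the right-hand side is quadratic in
  \<open>F\<close>, and by the second claim it is tight for the \<open>F\<close> to which
  \<open>U\<close> belongs.\<close>

lemma resolvent_le_mmse:
  fixes F :: "complex^'s^'r" and H :: "complex^'t^'s" and U :: "complex^'t^'r"
  shows "H \<bullet> (resolvent F ** H) \<le> (norm (H - adj F ** U))\<^sup>2 + (norm U)\<^sup>2"
    and "U = F ** resolvent F ** H \<Longrightarrow>
      H \<bullet> (resolvent F ** H) = (norm (resolvent F ** H))\<^sup>2 + (norm U)\<^sup>2"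
proof -
  define V U0 D where "V = resolvent F ** H" and "U0 = F ** V" and "D = U - U0"
  have "(adj F ** F) ** V = H - V"
    by (simp add: V_def matrix_mul_assoc gram_resolvent matrix_ring_simps)
  then have V: "adj F ** U0 = H - V"
    by (simp add: U0_def matrix_mul_assoc)
  have "U0 \<bullet> U0 = V \<bullet> (adj F ** U0)"
    by (simp add: U0_def inner_matrix_left)
  then have eq: "H \<bullet> V = V \<bullet> V + U0 \<bullet> U0"
    by (simp add: V inner_diff_right inner_commute)
  have "V \<bullet> (adj F ** D) = U0 \<bullet> D"
    by (simp add: U0_def inner_matrix_left)
  moreover have "H - adj F ** U = V - adj F ** D" "U = U0 + D"
    by (simp_all add: D_def matrix_ring_simps V)
  ultimately have "(norm (H - adj F ** U))\<^sup>2 + (norm U)\<^sup>2 = H \<bullet> V + (adj F ** D) \<bullet> (adj F ** D) + D \<bullet> D"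
    by (simp add: power2_norm_eq_inner inner_diff_left inner_diff_right inner_add_left inner_add_right inner_commute eq)
  then show "H \<bullet> (resolvent F ** H) \<le> (norm (H - adj F ** U))\<^sup>2 + (norm U)\<^sup>2"
    by (simp add: V_def)
  show "H \<bullet> (resolvent F ** H) = (norm (resolvent F ** H))\<^sup>2 + (norm U)\<^sup>2" if "U = F ** resolvent F ** H"
    using eq that by (simp add: V_def U0_def power2_norm_eq_inner matrix_mul_assoc)
qed

text \<open>The companion square, around V0 = G H, leaves the deficit |D|^2 + |F D|^2 with D = V -
  V0. It exhibits the objective as an attained supremum of functions that are polynomial in
  \<open>F\<close>.\<close>

lemma resolvent_ge_dual:
  fixes F :: "complex^'s^'r" and H V :: "complex^'t^'s"
  shows "2 * (H \<bullet> V) - V \<bullet> V - (F ** V) \<bullet> (F ** V) \<le> H \<bullet> (resolvent F ** H)"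
    and "V = resolvent F ** H \<Longrightarrow> 2 * (H \<bullet> V) - V \<bullet> V - (F ** V) \<bullet> (F ** V) = H \<bullet> (resolvent F ** H)"
proof -
  define V0 D where "V0 = resolvent F ** H" and "D = V - V0"
  have H: "H = V0 + adj F ** (F ** V0)"
    by (simp add: V0_def matrix_mul_assoc gram_resolvent matrix_ring_simps)
  have HX: "H \<bullet> X = V0 \<bullet> X + (F ** V0) \<bullet> (F ** X)" for X
    by (subst H) (simp add: inner_add_left inner_matrix_left)
  have "V = V0 + D" by (simp add: D_def)
  then have "2 * (H \<bullet> V) - V \<bullet> V - (F ** V) \<bullet> (F ** V) = H \<bullet> V0 - D \<bullet> D - (F ** D) \<bullet> (F ** D)"
    by (simp add: HX matrix_ring_simps inner_add_left inner_add_right inner_commute [of D V0]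
        inner_commute [of "F ** D" "F ** V0"])
  then show "2 * (H \<bullet> V) - V \<bullet> V - (F ** V) \<bullet> (F ** V) \<le> H \<bullet> (resolvent F ** H)"
    using inner_ge_zero [of D] inner_ge_zero [of "F ** D"] unfolding V0_def by linarith
  show "2 * (H \<bullet> V) - V \<bullet> V - (F ** V) \<bullet> (F ** V) = H \<bullet> (resolvent F ** H)" if "V = resolvent F ** H"
    using that by (simp add: HX flip: V0_def)
qed

section \<open>Existence and stationarity of the optimum\<close>

text \<open>Such an \<open>f\<close> is lower semicontinuous. If every \<open>y\<close> were beaten
  by some \<open>z y\<close>, then \<open>f\<close> would exceed \<open>f (z y)\<close> on a whole
  neighbourhood \<open>U y\<close>; in a finite subcover, the point \<open>z m\<close> with the
  smallest value lies in some \<open>U y\<close>, which forces \<open>f (z y)\<close> to be smaller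
  still.\<close>

lemma compact_attains_inf_of_sup:
  fixes f :: "'a::topological_space \<Rightarrow> real"
  assumes "compact S" "S \<noteq> {}"
    and cont: "\<And>v. continuous_on UNIV (\<lambda>y. g y v)"
    and le: "\<And>y v. g y v \<le> f y" and attained: "\<And>y. \<exists>v. g y v = f y"
  shows "\<exists>y\<in>S. \<forall>z\<in>S. f y \<le> f z"
proof (rule ccontr)
  assume "\<not> ?thesis"
  then have "\<forall>y\<in>S. \<exists>z\<in>S. f z < f y"
    by (auto simp: not_le)
  then obtain z where z: "\<And>y. y \<in> S \<Longrightarrow> z y \<in> S \<and> f (z y) < f y" by metis
  obtain v where v: "\<And>y. g y (v y) = f y" using attained by metis
  define U where "U y = {x. f (z y) < g x (v y)}" for y
  have "open (U y)" for y
    unfolding U_def by (intro open_Collect_less cont continuous_on_const)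
  moreover have "S \<subseteq> (\<Union>y\<in>S. U y)"
    using z v by (auto simp: U_def)
  ultimately obtain T where T: "T \<subseteq> S" "finite T" "S \<subseteq> (\<Union>y\<in>T. U y)"
    using compactE_image [OF \<open>compact S\<close>, of S U] by blast
  with \<open>S \<noteq> {}\<close> have "T \<noteq> {}" by auto
  define m where "m = arg_min_on (f \<circ> z) T"
  have m: "m \<in> T" "\<And>y. y \<in> T \<Longrightarrow> f (z m) \<le> f (z y)"
    using arg_min_if_finite [OF \<open>finite T\<close> \<open>T \<noteq> {}\<close>, of "f \<circ> z"] unfolding m_def by (auto simp: not_less)
  have "z m \<in> S" using m(1) T(1) z by blast
  then obtain y where "y \<in> T" "z m \<in> U y" using T(3) by blast
  then have "f (z y) < f (z m)"
    using le [of "z m" "v y"] by (simp add: U_def)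
  then show False using m(2) [OF \<open>y \<in> T\<close>] by simp
qed

text \<open>The component \<open>e\<close> of \<open>g\<close> orthogonal to \<open>h\<close> is
  tested by the direction e - r h, on which \<open>h\<close> is negative for every r > 0; letting r
  be small forces \<open>e = 0\<close>. No sign of \<open>n\<close> is claimed: the sign that
  matters is recovered later from positive eigenvalues of the Gram matrix.\<close>

lemma lagrange_multiplier:
  fixes g h :: "'a::real_inner"
  assumes descent: "\<And>d. h \<bullet> d < 0 \<Longrightarrow> g \<bullet> d \<le> 0" and "h = 0 \<Longrightarrow> g = 0"
  shows "\<exists>n. g = n *\<^sub>R h"
proof (cases "h = 0")
  case False
  define n where "n = (g \<bullet> h) / (h \<bullet> h)"
  define e where "e = g - n *\<^sub>R h"
  have hh: "0 < h \<bullet> h" using False by simp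
  have he: "h \<bullet> e = 0"
    using hh by (simp add: e_def n_def inner_diff_right inner_commute)
  have ge: "g \<bullet> e = e \<bullet> e"
    using he by (simp add: e_def inner_diff_left inner_commute)
  have bound: "e \<bullet> e \<le> r * (g \<bullet> h)" if "0 < r" for r
  proof -
    have "h \<bullet> (e - r *\<^sub>R h) < 0"
      using hh that by (simp add: inner_diff_right he)
    from descent [OF this] show ?thesis
      by (simp add: inner_diff_right ge)
  qed
  have "e \<bullet> e \<le> 0"
  proof (rule ccontr)
    assume *: "\<not> e \<bullet> e \<le> 0"
    define r where "r = (e \<bullet> e) / (2 * (\<bar>g \<bullet> h\<bar> + 1))"
    have "0 < r" unfolding r_def using * by (intro divide_pos_pos) auto
    have "e \<bullet> e \<le> r * (g \<bullet> h)" by (rule bound) fact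
    also have "\<dots> \<le> r * (\<bar>g \<bullet> h\<bar> + 1)"
      using \<open>0 < r\<close> by (intro mult_left_mono) auto
    also have "\<dots> = (e \<bullet> e) / 2"
      by (simp add: r_def field_simps add_nonneg_eq_0_iff)
    finally show False using * by simp
  qed
  then have "e = 0" by (metis inner_ge_zero inner_eq_zero_iff order_antisym)
  then show ?thesis by (auto simp: e_def)
qed (use assms in auto)

text \<open>The transmit power tr (Y C Y^H) split into amplified noise and forwarded signal. As a
  sum of squares it shows at once that the feasible set is closed and bounded.\<close>

definition relay_power :: "real \<Rightarrow> complex^'t^'s \<Rightarrow> complex^'s^'u \<Rightarrow> real" where
  "relay_power k H1 Y = (norm Y)\<^sup>2 + k * (norm (Y ** H1))\<^sup>2"

lemma relay_power_trace:
  "Re (trace (Y ** (mat 1 + k *\<^sub>R (H1 ** adj H1)) ** adj Y)) = relay_power k H1 Y"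
proof -
  have "Re (trace (Y ** (mat 1 + k *\<^sub>R (H1 ** adj H1)) ** adj Y)) = Y \<bullet> (Y ** (mat 1 + k *\<^sub>R (H1 ** adj H1)))"
    by (subst trace_mul_sym) (simp add: Re_trace_adj)
  also have "\<dots> = relay_power k H1 Y"
    by (simp add: relay_power_def matrix_ring_simps inner_add_right power2_norm_eq_inner matrix_mul_assoc inner_matrix_right)
  finally show ?thesis .
qed

lemma relay_optimum_exists:
  fixes H1 :: "complex^'t^'s" and H2 :: "complex^'u^'r"
  assumes "0 \<le> k" "0 \<le> P"
  obtains Y :: "complex^'s^'u" where "relay_power k H1 Y \<le> P"
    "\<And>Z. relay_power k H1 Z \<le> P \<Longrightarrow>
      H1 \<bullet> (resolvent (H2 ** Y) ** H1) \<le> H1 \<bullet> (resolvent (H2 ** Z) ** H1)"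
proof -
  have contL: "continuous_on UNIV (\<lambda>Y :: complex^'s^'u. Y ** V)" for V :: "complex^'t^'s"
    unfolding matrix_matrix_mult_def by (intro continuous_intros continuous_on_vec_lambda)
  have contR: "continuous_on UNIV (\<lambda>Y :: complex^'s^'u. H2 ** Y ** V)" for V :: "complex^'t^'s"
    unfolding matrix_matrix_mult_def by (intro continuous_intros continuous_on_vec_lambda)
  define S where "S = {Y :: complex^'s^'u. relay_power k H1 Y \<le> P}"
  have "closed S"
    unfolding S_def relay_power_def by (intro closed_Collect_le continuous_intros contL)
  moreover have "bounded S"
  proof (rule boundedI)
    fix Y assume "Y \<in> S"
    then have "(norm Y)\<^sup>2 + k * (norm (Y ** H1))\<^sup>2 \<le> P" by (simp add: S_def relay_power_def)
    moreover have "0 \<le> k * (norm (Y ** H1))\<^sup>2" using \<open>0 \<le> k\<close> by simp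
    ultimately have "(norm Y)\<^sup>2 \<le> P" by linarith
    then show "norm Y \<le> sqrt P" by (simp add: real_le_rsqrt)
  qed
  ultimately have "compact S" by (simp add: compact_eq_bounded_closed)
  have "0 \<in> S" using \<open>0 \<le> P\<close> by (simp add: S_def relay_power_def)
  have "\<exists>y\<in>S. \<forall>z\<in>S. H1 \<bullet> (resolvent (H2 ** y) ** H1) \<le> H1 \<bullet> (resolvent (H2 ** z) ** H1)"
  proof (rule compact_attains_inf_of_sup [where g = "\<lambda>Y V. 2 * (H1 \<bullet> V) - V \<bullet> V - (H2 ** Y ** V) \<bullet> (H2 ** Y ** V)"])
    show "S \<noteq> {}" using \<open>0 \<in> S\<close> by blast
    show "\<exists>V. 2 * (H1 \<bullet> V) - V \<bullet> V - (H2 ** Y ** V) \<bullet> (H2 ** Y ** V) = H1 \<bullet> (resolvent (H2 ** Y) ** H1)" for Y :: "complex^'s^'u"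
      using resolvent_ge_dual(2) by blast
  qed (intro \<open>compact S\<close> resolvent_ge_dual(1) continuous_intros contR)+
  then show ?thesis
    using that by (auto simp: S_def)
qed

text \<open>A direction along which the power strictly decreases stays feasible for small steps,
  whether or not the constraint is active. Along it the quadratic majorant must not decrease to
  first order, and that is the hypothesis of the multiplier lemma.\<close>

lemma relay_optimum_stationary:
  fixes H1 :: "complex^'t^'s" and H2 :: "complex^'u^'r" and Y :: "complex^'s^'u"
  assumes "0 \<le> k" and feas: "relay_power k H1 Y \<le> P"
    and opt: "\<And>Z. relay_power k H1 Z \<le> P \<Longrightarrow>
      H1 \<bullet> (resolvent (H2 ** Y) ** H1) \<le> H1 \<bullet> (resolvent (H2 ** Z) ** H1)"
  defines "G \<equiv> resolvent (H2 ** Y)"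
  shows "\<exists>n. adj H2 ** H2 ** Y ** (G ** (H1 ** adj H1) ** G) = n *\<^sub>R (Y ** (mat 1 + k *\<^sub>R (H1 ** adj H1)))"
proof (rule lagrange_multiplier)
  let ?g = "adj H2 ** H2 ** Y ** (G ** (H1 ** adj H1) ** G)"
  let ?h = "Y ** (mat 1 + k *\<^sub>R (H1 ** adj H1))"
  \<comment> \<open>\<open>U\<close> is the optimal estimator for \<open>Y\<close>; it stays frozen
    while \<open>Y\<close> moves along \<open>d\<close>, so that the bound on the objective is
    quadratic in the step \<open>e\<close>.\<close>
  define U V where "U = H2 ** Y ** G ** H1" and "V = adj H2 ** U"
  have power: "relay_power k H1 (Y + e *\<^sub>R d) = relay_power k H1 Y + 2 * e * (?h \<bullet> d) + e\<^sup>2 * relay_power k H1 d" for e d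
    unfolding relay_power_def using inner_commute [of "d ** H1" "Y ** H1"]
    by (simp add: matrix_ring_simps matrix_mul_assoc inner_matrix_right power2_norm_eq_inner inner_add_left inner_add_right)
      (simp add: inner_commute power2_eq_square algebra_simps)
  have obj: "H1 \<bullet> (resolvent (H2 ** (Y + e *\<^sub>R d)) ** H1)
      \<le> H1 \<bullet> (G ** H1) - 2 * e * (?g \<bullet> d) + e\<^sup>2 * (norm (adj d ** V))\<^sup>2" for e d
  proof -
    have 1: "H1 - adj (H2 ** (Y + e *\<^sub>R d)) ** U = G ** H1 - e *\<^sub>R (adj d ** V)"
    proof -
      have "adj (H2 ** Y) ** U = (mat 1 - G) ** H1"
        using gram_resolvent [of "H2 ** Y"] by (simp add: U_def G_def matrix_mul_assoc)
      then show ?thesis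
        by (simp add: V_def adj_mult adj_add adj_scaleR matrix_ring_simps matrix_mul_assoc)
    qed
    have 2: "(G ** H1) \<bullet> (adj d ** V) = ?g \<bullet> d"
    proof -
      have "(G ** H1) \<bullet> (adj d ** V) = d \<bullet> (V ** adj (G ** H1))"
        using inner_matrix_left [of d "G ** H1" V] inner_matrix_right [of d "G ** H1" V] by simp
      also have "V ** adj (G ** H1) = ?g"
        by (simp add: V_def U_def adj_mult G_def adj_resolvent matrix_mul_assoc)
      finally show ?thesis by (simp add: inner_commute)
    qed
    have "H1 \<bullet> (resolvent (H2 ** (Y + e *\<^sub>R d)) ** H1) \<le> (norm (G ** H1 - e *\<^sub>R (adj d ** V)))\<^sup>2 + (norm U)\<^sup>2"
      using resolvent_le_mmse(1) [of H1 "H2 ** (Y + e *\<^sub>R d)" U] by (simp only: 1)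
    also have "\<dots> = (norm (G ** H1))\<^sup>2 + (norm U)\<^sup>2 - 2 * e * (?g \<bullet> d) + e\<^sup>2 * (norm (adj d ** V))\<^sup>2"
      by (simp add: power2_norm_eq_inner inner_diff_left inner_diff_right 2 [symmetric])
        (simp add: inner_commute power2_eq_square algebra_simps)
    also have "(norm (G ** H1))\<^sup>2 + (norm U)\<^sup>2 = H1 \<bullet> (G ** H1)"
      unfolding G_def using resolvent_le_mmse(2) [of U "H2 ** Y" H1] by (simp add: U_def G_def)
    finally show ?thesis .
  qed
  show "?g \<bullet> d \<le> 0" if hd: "?h \<bullet> d < 0" for d
  proof (rule ccontr)
    assume gd: "\<not> ?g \<bullet> d \<le> 0"
    define a b p c where "a = - (?h \<bullet> d)" and "b = ?g \<bullet> d"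
      and "p = relay_power k H1 d" and "c = (norm (adj d ** V))\<^sup>2"
    have ab: "0 < a" "0 < b" using hd gd by (auto simp: a_def b_def)
    have pc: "0 \<le> p" "0 \<le> c" using \<open>0 \<le> k\<close> by (auto simp: p_def c_def relay_power_def)
    \<comment> \<open>Makes each quadratic term at most half of its linear term, in the power and in
      the objective simultaneously.\<close>
    define e where "e = min (a / (p + 1)) (b / (c + 1))"
    have "0 < e" using ab pc by (simp add: e_def)
    have ep: "e * p \<le> a"
    proof -
      have "e * p \<le> (a / (p + 1)) * (p + 1)"
        using ab pc \<open>0 < e\<close> by (intro mult_mono) (auto simp: e_def)
      then show ?thesis using pc by simp
    qed
    have ec: "e * c \<le> b"
    proof -
      have "e * c \<le> (b / (c + 1)) * (c + 1)"
        using ab pc \<open>0 < e\<close> by (intro mult_mono) (auto simp: e_def)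
      then show ?thesis using pc by simp
    qed
    have "e * (e * p) \<le> e * a" "e * (e * c) \<le> e * b" "0 < e * a" "0 < e * b"
      using ep ec ab \<open>0 < e\<close> by (auto intro: mult_left_mono)
    then have small: "- 2 * e * a + e\<^sup>2 * p \<le> 0" "- 2 * e * b + e\<^sup>2 * c < 0"
      by (auto simp: power2_eq_square algebra_simps)
    have "relay_power k H1 (Y + e *\<^sub>R d) \<le> P"
      using power [of e d] small(1) feas by (simp add: a_def p_def)
    then have "H1 \<bullet> (G ** H1) \<le> H1 \<bullet> (resolvent (H2 ** (Y + e *\<^sub>R d)) ** H1)"
      unfolding G_def by (rule opt)
    then show False
      using obj [of e d] small(2) by (simp add: b_def c_def)
  qed
  \<comment> \<open>The power gradient degenerates only at the origin: its inner product with
    \<open>Y\<close> is the power itself, so \<open>Y = 0\<close> and \<open>?g\<close> vanishes as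
    well.\<close>
  show "?g = 0" if "?h = 0"
  proof -
    have "Y \<bullet> ?h = relay_power k H1 Y"
      by (simp add: relay_power_def matrix_ring_simps inner_add_right power2_norm_eq_inner matrix_mul_assoc inner_matrix_right)
    then have "relay_power k H1 Y = 0"
      using that by simp
    moreover have "0 \<le> k * (norm (Y ** H1))\<^sup>2" using \<open>0 \<le> k\<close> by simp
    ultimately have "(norm Y)\<^sup>2 \<le> 0"
      unfolding relay_power_def by linarith
    then have "Y = 0" by simp
    then show ?thesis
      by simp
  qed
qed

section \<open>Commutation at a stationary point\<close>

text \<open>With \<open>R = AG - GA\<close> and \<open>W = I - G\<close> the hypothesis becomes the Lyapunov equation
  \<open>R + k (W A R + R A W) = 0\<close>. Since \<open>W\<close> and \<open>A\<close> are positive semidefinite, it forces first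
  \<open>A R A = 0\<close>, then \<open>A R = 0\<close>, then \<open>R = 0\<close>.\<close>

lemma resolvent_commutes_at_stationary_point:
  fixes H1 :: "complex^'t^'s" and F :: "complex^'s^'r"
  assumes "0 \<le> k"
  defines "A \<equiv> H1 ** adj H1" and "G \<equiv> resolvent F"
  assumes stat: "(mat 1 + k *\<^sub>R A) ** (mat 1 - G) ** A ** G = G ** A ** (mat 1 - G) ** (mat 1 + k *\<^sub>R A)"
  shows "A ** G = G ** A"
proof -
  define R W where "R = A ** G - G ** A" and "W = mat 1 - G"
  have adjA: "adj A = A" by (simp add: A_def adj_mult)
  have adjG: "adj G = G" by (simp add: G_def adj_resolvent)
  have adjR: "adj R = - R" by (simp add: R_def adj_diff adj_mult adjA adjG)
  have W: "0 \<le> X \<bullet> (W ** X)" for X :: "complex^'n^'s"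
    unfolding W_def G_def by (rule one_minus_resolvent_nonneg)
  have "R + k *\<^sub>R (W ** A ** R + R ** A ** W)
      = (mat 1 + k *\<^sub>R A) ** (mat 1 - G) ** A ** G - G ** A ** (mat 1 - G) ** (mat 1 + k *\<^sub>R A)"
    by (simp add: R_def W_def matrix_ring_simps matrix_mul_assoc algebra_simps)
  then have lyap: "R + k *\<^sub>R (W ** A ** R + R ** A ** W) = 0"
    by (simp add: stat)
  have left: "A ** R + k *\<^sub>R (A ** W ** A ** R + A ** R ** A ** W) = 0"
    using arg_cong [OF lyap, of "\<lambda>Z. A ** Z"] by (simp add: matrix_ring_simps matrix_mul_assoc)
  have both: "A ** R ** A + k *\<^sub>R (A ** W ** A ** R ** A + A ** R ** A ** W ** A) = 0"
    using arg_cong [OF left, of "\<lambda>Z. Z ** A"] by (simp add: matrix_ring_simps matrix_mul_assoc)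
  have right_A: "X \<bullet> (Z ** A) = (X ** H1) \<bullet> (Z ** H1)" for X Z :: "complex^'s^'n"
    by (simp add: A_def matrix_mul_assoc inner_matrix_right)
  have left_A: "X \<bullet> (A ** Z) = (adj H1 ** X) \<bullet> (adj H1 ** Z)" for X Z :: "complex^'n^'s"
    by (simp add: A_def matrix_mul_assoc inner_matrix_left)
  have left_A': "X \<bullet> (A ** Z) = (A ** X) \<bullet> Z" for X Z :: "complex^'n^'s"
    by (simp add: inner_matrix_left adjA)
  have c1: "0 \<le> R \<bullet> (A ** W ** A ** R ** A)"
  proof -
    have "R \<bullet> (A ** W ** A ** R ** A) = (R ** H1) \<bullet> (A ** (W ** (A ** R ** H1)))"
      by (simp add: right_A matrix_mul_assoc)
    also have "\<dots> = (A ** R ** H1) \<bullet> (W ** (A ** R ** H1))"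
      using left_A' [of "R ** H1" "W ** (A ** R ** H1)"] by (simp add: matrix_mul_assoc)
    finally show ?thesis by (simp add: W)
  qed
  \<comment> \<open>Taking adjoints interchanges the two products and, \<open>R\<close> being
    skew-Hermitian, produces two signs that cancel in the inner product.\<close>
  have c2: "R \<bullet> (A ** R ** A ** W ** A) = R \<bullet> (A ** W ** A ** R ** A)"
  proof -
    have "adj W = W" by (simp add: W_def adj_diff adjG)
    then have "adj (A ** R ** A ** W ** A) = - (A ** W ** A ** R ** A)"
      using matrix_mult_diff_right [of "A ** W ** A" 0 R] matrix_mult_diff_left [of 0 "A ** W ** A ** R" A]
      by (simp add: adj_mult adjA adjR matrix_mul_assoc)
    then show ?thesis
      using inner_adj_adj [of R "A ** R ** A ** W ** A"] by (simp add: adjR)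
  qed
  have "R \<bullet> (A ** R ** A) = (adj H1 ** R ** H1) \<bullet> (adj H1 ** R ** H1)"
    by (simp add: right_A) (simp add: left_A flip: matrix_mul_assoc)
  moreover have "R \<bullet> (A ** R ** A) + k * (2 * (R \<bullet> (A ** W ** A ** R ** A))) = 0"
    using arg_cong [OF both, of "\<lambda>Z. R \<bullet> Z"] by (simp add: inner_add_right c2)
  ultimately have "(adj H1 ** R ** H1) \<bullet> (adj H1 ** R ** H1) \<le> 0"
    using mult_nonneg_nonneg [OF \<open>0 \<le> k\<close> c1] by simp
  then have "adj H1 ** R ** H1 = 0"
    by (metis inner_ge_zero inner_eq_zero_iff order_antisym)
  then have "H1 ** (adj H1 ** R ** H1) ** adj H1 = 0"
    by simp
  then have ARA: "A ** R ** A = 0"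
    by (simp add: A_def matrix_mul_assoc)
  \<comment> \<open>With \<open>A ** R ** A = 0\<close> the one-sided product of the equation with
    \<open>A\<close> loses its second cross term, and the other one is nonnegative when tested
    against \<open>R\<close>.\<close>
  have "R \<bullet> (A ** R + k *\<^sub>R (A ** W ** A ** R)) = 0"
    using left by (simp only: ARA) simp
  then have "R \<bullet> (A ** R) + k * (R \<bullet> (A ** (W ** (A ** R)))) = 0"
    by (simp add: inner_add_right matrix_mul_assoc)
  moreover have "0 \<le> R \<bullet> (A ** (W ** (A ** R)))"
    unfolding left_A' [of R] by (rule W)
  ultimately have "R \<bullet> (A ** R) \<le> 0"
    using mult_nonneg_nonneg [OF \<open>0 \<le> k\<close>, of "R \<bullet> (A ** (W ** (A ** R)))"] by linarith
  then have "(adj H1 ** R) \<bullet> (adj H1 ** R) \<le> 0"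
    by (simp add: left_A)
  then have "adj H1 ** R = 0"
    by (metis inner_ge_zero inner_eq_zero_iff order_antisym)
  then have "H1 ** (adj H1 ** R) = 0"
    by simp
  then have AR: "A ** R = 0"
    by (simp add: A_def matrix_mul_assoc)
  \<comment> \<open>Skew-Hermiticity carries the vanishing over to \<open>R ** A\<close>, so both
    cross terms of the Lyapunov equation disappear and only \<open>R\<close> is left.\<close>
  have "adj (A ** R) = - (R ** A)"
    using matrix_mult_diff_left [of 0 R A] by (simp add: adj_mult adjR adjA)
  then have "R ** A = 0"
    using AR by (simp add: adj_def vec_eq_iff)
  then have "R = 0"
    using lyap by (simp add: AR flip: matrix_mul_assoc)
  then show ?thesis by (simp add: R_def)
qed

text \<open>Multiplying the stationarity condition by C Y^H from the left turns its right-hand side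
  into n C Q C with Q = Y^H Y, which is Hermitian; equating the left-hand side with its adjoint is
  the hypothesis of the preceding lemma. Commutation with \<open>G\<close> then passes to its
  inverse I + M.\<close>

lemma gram_commutes_at_stationary_point:
  fixes H1 :: "complex^'t^'s" and Y :: "complex^'s^'u" and H2 :: "complex^'u^'r"
  assumes "0 \<le> k"
  defines "A \<equiv> H1 ** adj H1" and "F \<equiv> H2 ** Y"
  defines "G \<equiv> resolvent F" and "C \<equiv> mat 1 + k *\<^sub>R A"
  assumes stat: "adj H2 ** H2 ** Y ** (G ** A ** G) = n *\<^sub>R (Y ** C)"
  shows "A ** (adj F ** F) = (adj F ** F) ** A"
proof -
  define M Q where "M = adj F ** F" and "Q = adj Y ** Y"
  have adjA: "adj A = A" by (simp add: A_def adj_mult)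
  have adjC: "adj C = C" by (simp add: C_def adj_add adj_scaleR adjA)
  have adjG: "adj G = G" by (simp add: G_def adj_resolvent)
  have adjM: "adj M = M" by (simp add: M_def adj_mult)
  have MG: "M ** G = mat 1 - G" "G ** M = mat 1 - G"
    using gram_resolvent [of F] resolvent_gram [of F] by (simp_all add: G_def M_def matrix_mul_assoc)
  have "M ** G ** A ** G = adj Y ** (adj H2 ** H2 ** Y ** (G ** A ** G))"
    by (simp add: M_def F_def adj_mult matrix_mul_assoc)
  also have "\<dots> = n *\<^sub>R (Q ** C)"
    by (simp only: stat) (simp add: matrix_ring_simps Q_def matrix_mul_assoc)
  finally have 1: "(mat 1 - G) ** A ** G = n *\<^sub>R (Q ** C)"
    by (simp add: MG)
  have "adj ((mat 1 - G) ** A ** G) = n *\<^sub>R (C ** Q)"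
    by (simp add: 1 adj_scaleR adj_mult adjC Q_def)
  then have 2: "G ** A ** (mat 1 - G) = n *\<^sub>R (C ** Q)"
    by (simp add: adj_mult adj_diff adjA adjG matrix_mul_assoc)
  have "C ** (mat 1 - G) ** A ** G = C ** ((mat 1 - G) ** A ** G)"
    by (simp add: matrix_mul_assoc)
  also have "\<dots> = G ** A ** (mat 1 - G) ** C"
    by (simp only: 1 2) (simp add: matrix_ring_simps matrix_mul_assoc)
  finally have AG: "A ** G = G ** A"
    using resolvent_commutes_at_stationary_point [OF \<open>0 \<le> k\<close>, of H1 F] by (simp add: A_def G_def C_def)
  define L where "L = mat 1 + M"
  have LG: "L ** G = mat 1" "G ** L = mat 1"
    by (simp_all add: L_def G_def M_def resolvent_left_inverse resolvent_right_inverse)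
  have "A ** L = (L ** G) ** A ** L" by (simp add: LG)
  also have "\<dots> = L ** (G ** A) ** L" by (simp add: matrix_mul_assoc)
  also have "\<dots> = L ** A ** (G ** L)" by (simp add: matrix_mul_assoc flip: AG)
  finally have "A ** L = L ** A" by (simp add: LG)
  then show ?thesis
    by (simp add: L_def M_def matrix_ring_simps)
qed

section \<open>Objective and power in a common eigenbasis\<close>

text \<open>Traces evaluated in a common eigenbasis turn objective and power into sums over modes.
  It serves both for the abstract optimum, in the basis obtained from commutation, and for the
  explicit \<open>X\<close>, in the prescribed eigenvectors \<open>a\<close>.\<close>

lemma resolvent_objective_eigenbasis:
  fixes H1 :: "complex^'t^'s" and Y :: "complex^'s^'u" and H2 :: "complex^'u^'r"
  defines "A \<equiv> H1 ** adj H1" and "M \<equiv> adj (H2 ** Y) ** (H2 ** Y)"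
  assumes "finite I" and expand: "\<And>x. x = (\<Sum>i\<in>I. cinner (w i) x *s w i)"
    and orth: "orthonormal_family I w"
    and A_eig: "\<forall>i\<in>I. A *v w i = complex_of_real (al i) *s w i"
    and M_eig: "\<forall>i\<in>I. M *v w i = complex_of_real (m i) *s w i"
  shows "i \<in> I \<Longrightarrow> 0 \<le> m i" and "i \<in> I \<Longrightarrow> 0 \<le> al i"
    and "i \<in> I \<Longrightarrow> resolvent (H2 ** Y) *v w i = complex_of_real (1 / (1 + m i)) *s w i"
    and "H1 \<bullet> H1 - H1 \<bullet> (resolvent (H2 ** Y) ** H1) = (\<Sum>i\<in>I. al i * m i / (1 + m i))"
    and "relay_power k H1 Y = (\<Sum>i\<in>I. (1 + k * al i) * (norm (Y *v w i))\<^sup>2)"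
proof -
  note A = bspec [OF A_eig] and M = bspec [OF M_eig]
  define G where "G = resolvent (H2 ** Y)"
  have ww: "cinner (w i) (w i) = 1" if "i \<in> I" for i
    using orthonormal_familyD [OF orth that that] by simp
  show m_nonneg: "0 \<le> m i" if "i \<in> I" for i
  proof -
    have "cinner (w i) (M *v w i) = cinner ((H2 ** Y) *v w i) ((H2 ** Y) *v w i)"
      by (simp add: M_def cinner_adj flip: matrix_vector_mul_assoc)
    then have "complex_of_real (m i) = complex_of_real ((norm ((H2 ** Y) *v w i))\<^sup>2)"
      using that by (simp only: M cinner_scale_right ww mult_1_right cinner_self [of "(H2 ** Y) *v w i"])
    then show ?thesis
      by (metis of_real_eq_iff zero_le_power2)
  qed
  show "0 \<le> al i" if "i \<in> I" for i
  proof -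
    have "cinner (w i) (A *v w i) = cinner (adj H1 *v w i) (adj H1 *v w i)"
      by (simp add: A_def cinner_adj flip: matrix_vector_mul_assoc)
    then have "complex_of_real (al i) = complex_of_real ((norm (adj H1 *v w i))\<^sup>2)"
      using that by (simp only: A cinner_scale_right ww mult_1_right cinner_self [of "adj H1 *v w i"])
    then show ?thesis
      by (metis of_real_eq_iff zero_le_power2)
  qed
  have G: "G *v w i = complex_of_real (1 / (1 + m i)) *s w i" if "i \<in> I" for i
  proof -
    have "w i = G *v ((mat 1 + M) *v w i)"
      using resolvent_left_inverse [of "H2 ** Y"] by (simp add: G_def M_def matrix_vector_mul_assoc)
    also have "(mat 1 + M) *v w i = complex_of_real (1 + m i) *s w i"
      using that by (simp add: matrix_vector_mult_add_rdistrib M)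
    finally have "w i = complex_of_real (1 + m i) *s (G *v w i)"
      unfolding vector_scalar_commute .
    then have "complex_of_real (1 / (1 + m i)) *s w i = complex_of_real (1 / (1 + m i)) *s (complex_of_real (1 + m i) *s (G *v w i))"
      by (rule arg_cong)
    also have "\<dots> = G *v w i"
      using m_nonneg [OF that] unfolding vector_smult_assoc of_real_mult [symmetric] by simp
    finally show ?thesis ..
  qed
  then show "i \<in> I \<Longrightarrow> resolvent (H2 ** Y) *v w i = complex_of_real (1 / (1 + m i)) *s w i"
    by (simp add: G_def)
  have tr: "H1 \<bullet> (Z ** H1) = Re (\<Sum>i\<in>I. cinner (w i) (Z *v (A *v w i)))" for Z
  proof -
    have "H1 \<bullet> (Z ** H1) = Re (trace ((Z ** H1) ** adj H1))"
      by (subst trace_mul_sym) (simp add: Re_trace_adj)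
    then show ?thesis
      by (simp add: trace_orthonormal_expansion [OF \<open>finite I\<close> expand] A_def matrix_mul_assoc matrix_vector_mul_assoc)
  qed
  have "H1 \<bullet> (G ** H1) = (\<Sum>i\<in>I. al i / (1 + m i))"
    by (simp add: tr A vector_scalar_commute G cinner_scale_right ww)
  moreover have "H1 \<bullet> H1 = (\<Sum>i\<in>I. al i)"
    using tr [of "mat 1"] by (simp add: A cinner_scale_right ww)
  ultimately have "H1 \<bullet> H1 - H1 \<bullet> (G ** H1) = (\<Sum>i\<in>I. al i - al i / (1 + m i))"
    by (simp add: sum_subtractf)
  also have "\<dots> = (\<Sum>i\<in>I. al i * m i / (1 + m i))"
  proof (intro sum.cong refl)
    fix i assume "i \<in> I"
    then have "1 + m i \<noteq> 0" using m_nonneg [of i] by simp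
    then show "al i - al i / (1 + m i) = al i * m i / (1 + m i)"
      by (simp add: field_simps)
  qed
  finally show "H1 \<bullet> H1 - H1 \<bullet> (resolvent (H2 ** Y) ** H1) = (\<Sum>i\<in>I. al i * m i / (1 + m i))"
    by (simp add: G_def)
  have "relay_power k H1 Y = Re (trace (adj Y ** Y ** (mat 1 + k *\<^sub>R A)))"
    unfolding relay_power_trace [symmetric] A_def by (subst trace_mul_sym) (simp add: matrix_mul_assoc)
  also have "\<dots> = Re (\<Sum>i\<in>I. cinner (w i) ((adj Y ** Y ** (mat 1 + k *\<^sub>R A)) *v w i))"
    by (simp add: trace_orthonormal_expansion [OF \<open>finite I\<close> expand])
  also have "\<dots> = (\<Sum>i\<in>I. (1 + k * al i) * (norm (Y *v w i))\<^sup>2)"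
  proof -
    have "cinner (w i) ((adj Y ** Y ** (mat 1 + k *\<^sub>R A)) *v w i)
        = complex_of_real ((1 + k * al i) * (norm (Y *v w i))\<^sup>2)" if "i \<in> I" for i
    proof -
      have "(mat 1 + k *\<^sub>R A) *v w i = complex_of_real (1 + k * al i) *s w i"
        using that by (simp add: matrix_vector_mult_add_rdistrib matrix_vector_mult_scaleR_left A vector_smult_assoc flip: smult_of_real)
      then show ?thesis
        by (simp only: matrix_vector_mul_assoc [symmetric] vector_scalar_commute cinner_scale_right cinner_adj adj_adj cinner_self of_real_mult)
    qed
    then show ?thesis
      by (simp only: Re_sum cong: sum.cong) simp
  qed
  finally show "relay_power k H1 Y = (\<Sum>i\<in>I. (1 + k * al i) * (norm (Y *v w i))\<^sup>2)" .
qed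

text \<open>Independent vectors in the row space, as many as the rank, span it. A vector orthogonal
  to all the \<open>b i\<close> is then annihilated by every row of \<open>B\<close>.\<close>

lemma hermitian_eigenvectors_span_range:
  fixes B :: "complex^'u^'u" and b :: "nat \<Rightarrow> complex^'u"
  assumes herm: "adj B = B"
    and eig: "\<And>i. i < rank B \<Longrightarrow> B *v b i = complex_of_real (mu i) *s b i"
    and orth: "orthonormal_family {..<rank B} b"
    and mu: "\<And>i. i < rank B \<Longrightarrow> mu i \<noteq> 0"
    and z: "\<And>i. i < rank B \<Longrightarrow> cinner (b i) z = 0"
  shows "B *v z = 0"
proof -
  \<comment> \<open>Conjugated because a row acts on \<open>z\<close> bilinearly: the bilinear
    product of \<open>c i\<close> with \<open>z\<close> is the inner product of \<open>b i\<close>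
    with \<open>z\<close>.\<close>
  define c where "c i = (\<chi> k. cnj (b i $ k))" for i
  have "cinner (c i) (c j) = cinner (b j) (b i)" for i j
    by (simp add: cinner_def c_def mult.commute)
  then have orth_c: "orthonormal_family {..<rank B} c"
    using orth by (auto simp: orthonormal_family_def)
  have in_span: "c i \<in> vec.span (rows B)" if i: "i < rank B" for i
  proof -
    have B_sym: "cnj (B $ l $ k) = B $ k $ l" for k l
      using herm by (simp add: adj_def vec_eq_iff)
    have "c i $ l = (\<Sum>k\<in>UNIV. (cnj (b i $ k) / complex_of_real (mu i)) *s row k B) $ l" for l
    proof -
      have "(\<Sum>k\<in>UNIV. cnj (b i $ k) * B $ k $ l) = cnj ((B *v b i) $ l)"
        by (simp add: matrix_vector_mult_def B_sym mult.commute)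
      also have "\<dots> = complex_of_real (mu i) * c i $ l"
        by (simp add: eig [OF i] c_def)
      finally show ?thesis
        using mu [OF i] by (simp add: row_def flip: sum_divide_distrib)
    qed
    then have "c i = (\<Sum>k\<in>UNIV. (cnj (b i $ k) / complex_of_real (mu i)) *s row k B)"
      by (simp add: vec_eq_iff)
    also have "\<dots> \<in> vec.span (rows B)"
      by (intro vec.span_sum vec.span_scale vec.span_base) (auto simp: rows_def)
    finally show ?thesis .
  qed
  have "card (c ` {..<rank B}) = vec.dim (vec.span (rows B))"
    using orthonormal_family_independent(1) [OF orth_c] by (simp add: card_image row_rank_def_gen)
  then have "vec.span (rows B) \<subseteq> vec.span (c ` {..<rank B})"
    using in_span orthonormal_family_independent(2) [OF orth_c] vec.card_eq_dim [of "c ` {..<rank B}" "vec.span (rows B)"]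
    by auto
  then have row_span: "row k B \<in> vec.span (c ` {..<rank B})" for k
    using vec.span_base [of "row k B" "rows B"] by (auto simp: rows_def)
  have "(\<Sum>j\<in>UNIV. v $ j * z $ j) = 0" if "v \<in> vec.span (c ` {..<rank B})" for v
    using that
  proof (induction rule: vec.span_induct_alt)
    case (step s x y)
    then have "(\<Sum>j\<in>UNIV. x $ j * z $ j) = 0"
      using z by (auto simp: c_def cinner_def)
    then show ?case
      using step by (simp add: ring_distribs sum.distrib mult.assoc flip: sum_distrib_left)
  qed simp
  from this [OF row_span] show ?thesis
    by (simp add: vec_eq_iff matrix_vector_mult_def row_def)
qed

text \<open>The bound is proved for an optimum \<open>Y\<close>, where the mode structure is
  available, and inherited by every feasible \<open>Z\<close>. The result mentions only scalars, so
  it can be compared with the scalar problem directly.\<close>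

lemma relay_gain_upper_bound:
  fixes H1 :: "complex^'t^'s" and H2 :: "complex^'u^'r" and Z :: "complex^'s^'u"
    and a :: "nat \<Rightarrow> complex^'s" and b :: "nat \<Rightarrow> complex^'u" and alpha mu :: "nat \<Rightarrow> real"
  defines "A \<equiv> H1 ** adj H1" and "B \<equiv> adj H2 ** H2"
  assumes "0 \<le> k" "0 \<le> P"
    and a_eig: "\<And>i. i < CARD('s) \<Longrightarrow> A *v a i = complex_of_real (alpha i) *s a i"
    and a_orth: "orthonormal_family {..<CARD('s)} a"
    and alpha_nonneg: "\<And>i. i < CARD('s) \<Longrightarrow> 0 \<le> alpha i"
    and alpha_sorted: "\<And>i j. i \<le> j \<Longrightarrow> j < CARD('s) \<Longrightarrow> alpha j \<le> alpha i"
    and b_eig: "\<And>i. i < rank B \<Longrightarrow> B *v b i = complex_of_real (mu i) *s b i"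
    and b_orth: "orthonormal_family {..<rank B} b"
    and mu_pos: "\<And>i. i < rank B \<Longrightarrow> 0 < mu i"
    and mu_sorted: "\<And>i j. i \<le> j \<Longrightarrow> j < rank B \<Longrightarrow> mu j \<le> mu i"
    and Z: "relay_power k H1 Z \<le> P"
  obtains q p where "q \<le> CARD('s)" "q \<le> rank B" "\<And>i. i < q \<Longrightarrow> 0 \<le> p i"
    "(\<Sum>i<q. p i / mu i) \<le> P"
    "H1 \<bullet> H1 - H1 \<bullet> (resolvent (H2 ** Z) ** H1) \<le> (\<Sum>i<q. relay_gain k (alpha i) (p i))"
proof -
  obtain Y :: "complex^'s^'u" where Y: "relay_power k H1 Y \<le> P"
    and opt: "\<And>Z. relay_power k H1 Z \<le> P \<Longrightarrow>
      H1 \<bullet> (resolvent (H2 ** Y) ** H1) \<le> H1 \<bullet> (resolvent (H2 ** Z) ** H1)"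
    using relay_optimum_exists [OF \<open>0 \<le> k\<close> \<open>0 \<le> P\<close>, of H1 H2] by blast
  define G M where "G = resolvent (H2 ** Y)" and "M = adj (H2 ** Y) ** (H2 ** Y)"
  obtain n where stat: "B ** Y ** (G ** A ** G) = n *\<^sub>R (Y ** (mat 1 + k *\<^sub>R A))"
    using relay_optimum_stationary [OF \<open>0 \<le> k\<close> Y opt] unfolding A_def B_def G_def by blast
  have AM: "A ** M = M ** A"
    using gram_commutes_at_stationary_point [OF \<open>0 \<le> k\<close>] stat unfolding A_def B_def G_def M_def by blast
  have adjA: "adj A = A" and adjB: "adj B = B" and adjM: "adj M = M"
    by (simp_all add: A_def B_def M_def adj_mult matrix_mul_assoc)
  obtain S al m where S: "finite S" "orthonormal_family S (\<lambda>w. w)"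
    and al: "\<And>w. w \<in> S \<Longrightarrow> A *v w = complex_of_real (al w) *s w"
    and m: "\<And>w. w \<in> S \<Longrightarrow> M *v w = complex_of_real (m w) *s w"
    and expand: "\<And>x. x = (\<Sum>w\<in>S. cinner w x *s w)"
    by (rule commuting_hermitian_eigenbasis [OF adjA adjM AM]) (rule that)
  have "\<forall>w\<in>S. (H1 ** adj H1) *v w = complex_of_real (al w) *s w"
    and "\<forall>w\<in>S. (adj (H2 ** Y) ** (H2 ** Y)) *v w = complex_of_real (m w) *s w"
    using al m by (auto simp: A_def M_def)
  note basis = resolvent_objective_eigenbasis [OF \<open>finite S\<close> expand S(2) this]
  \<comment> \<open>The modes with nonzero gain. Here \<open>kappa\<close> is positive, so the
    stationarity condition can be solved for B Y w, and \<open>m w > 0\<close> keeps Y w from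
    vanishing.\<close>
  define J where "J = {w \<in> S. al w * m w \<noteq> 0}"
  have "finite J" "J \<subseteq> S" using S(1) by (auto simp: J_def)
  have Jpos: "w \<in> S" "0 < al w" "0 < m w" if "w \<in> J" for w
    using that basis(1,2) [of w] by (auto simp: J_def less_le)
  define c where "c w = 1 + k * al w" for w
  \<comment> \<open>The eigenvalue of G A G at \<open>w\<close>. Applied to \<open>w\<close>, the
    stationarity condition reads kappa B Y w = n c Y w, whence the eigenvalue \<open>mu'\<close> of
    B.\<close>
  define kappa where "kappa w = al w / (1 + m w)\<^sup>2" for w
  define mu' where "mu' w = n * c w / kappa w" for w
  have c_pos: "0 < c w" if "w \<in> S" for w
    using basis(2) [OF that] \<open>0 \<le> k\<close> by (simp add: c_def add_pos_nonneg)
  have MY: "M = adj Y ** (B ** Y)"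
    by (simp add: M_def B_def adj_mult matrix_mul_assoc)
  have YBY: "cinner (Y *v v) (B *v (Y *v w)) = complex_of_real (m w) * cinner v w" if "w \<in> S" for v w
  proof -
    have "cinner (Y *v v) (B *v (Y *v w)) = cinner v (M *v w)"
      by (simp add: MY cinner_adj [of v "adj Y"] flip: matrix_vector_mul_assoc)
    then show ?thesis by (simp add: m [OF that] cinner_scale_right)
  qed
  have BY: "B *v (Y *v w) = complex_of_real (mu' w) *s (Y *v w)" if w: "w \<in> J" for w
  proof -
    have kap: "0 < kappa w" using Jpos [OF w] by (simp add: kappa_def)
    have "(G ** A ** G) *v w = complex_of_real (kappa w) *s w"
      using basis(3) [OF Jpos(1) [OF w]] al [OF Jpos(1) [OF w]]
      by (simp add: G_def vector_scalar_commute vector_smult_assoc kappa_def power2_eq_square flip: matrix_vector_mul_assoc)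
    then have 1: "(B ** Y ** (G ** A ** G)) *v w = complex_of_real (kappa w) *s (B *v (Y *v w))"
      by (simp add: vector_scalar_commute flip: matrix_vector_mul_assoc)
    have "(mat 1 + k *\<^sub>R A) *v w = complex_of_real (c w) *s w"
      using al [OF Jpos(1) [OF w]]
      by (simp add: matrix_vector_mult_add_rdistrib matrix_vector_mult_scaleR_left vector_smult_assoc c_def flip: smult_of_real)
    then have 2: "(n *\<^sub>R (Y ** (mat 1 + k *\<^sub>R A))) *v w = complex_of_real (n * c w) *s (Y *v w)"
      by (simp add: matrix_vector_mult_scaleR_left vector_scalar_commute vector_smult_assoc flip: smult_of_real matrix_vector_mul_assoc)
    have "complex_of_real (1 / kappa w) *s (complex_of_real (kappa w) *s (B *v (Y *v w)))
        = complex_of_real (1 / kappa w) *s (complex_of_real (n * c w) *s (Y *v w))"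
      using 1 2 stat by simp
    then show ?thesis
      using kap unfolding vector_smult_assoc of_real_mult [symmetric] by (simp add: mu'_def)
  qed
  \<comment> \<open>Determines the length of Y w from the eigenvalues, and shows
    \<open>mu' w > 0\<close> because \<open>m w > 0\<close>.\<close>
  have m_eq: "m w = mu' w * (norm (Y *v w))\<^sup>2" if w: "w \<in> J" for w
  proof -
    have "complex_of_real (m w) = cinner (Y *v w) (B *v (Y *v w))"
      using YBY [of w w] orthonormal_familyD [OF S(2), of w w] Jpos(1) [OF w] by simp
    also have "\<dots> = complex_of_real (mu' w * (norm (Y *v w))\<^sup>2)"
      by (simp add: BY [OF w] cinner_scale_right cinner_self)
    finally show ?thesis by (simp only: of_real_eq_iff)
  qed
  have Yw: "Y *v w \<noteq> 0" "0 < mu' w" if "w \<in> J" for w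
    using m_eq [OF that] Jpos(3) [OF that] by (auto simp: zero_less_mult_iff)
  define y where "y w = complex_of_real (1 / norm (Y *v w)) *s (Y *v w)" for w
  have By: "B *v y w = complex_of_real (mu' w) *s y w" if "w \<in> J" for w
    unfolding y_def vector_scalar_commute BY [OF that] by (simp add: vector_smult_assoc)
  have y_orth: "orthonormal_family J y"
    unfolding orthonormal_family_def
  proof (intro ballI)
    fix v w assume vw: "v \<in> J" "w \<in> J"
    show "cinner (y v) (y w) = (if v = w then 1 else 0)"
    proof (cases "v = w")
      case True
      then show ?thesis
        unfolding y_def smult_of_real using Yw(1) [OF vw(2)] by (simp add: cinner_self)
    next
      case False
      \<comment> \<open>Diagonality of M gives orthogonality only in the form defined by B; the
        eigenvalue equation upgrades it to ordinary orthogonality.\<close>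
      then have "complex_of_real (mu' w) * cinner (Y *v v) (Y *v w) = 0"
        using YBY [of w v] Jpos(1) [OF vw(1)] Jpos(1) [OF vw(2)] orthonormal_familyD [OF S(2), of v w]
        by (simp add: BY [OF vw(2)] cinner_scale_right)
      then show ?thesis
        using False Yw(2) [OF vw(2)] by (simp add: y_def cinner_scale_left cinner_scale_right)
    qed
  qed
  have y_expand: "y w = (\<Sum>i<rank B. cinner (b i) (y w) *s b i)" if w: "w \<in> J" for w
  proof -
    \<comment> \<open>The residual lies in the kernel of B, hence is orthogonal to the eigenvector
      \<open>y w\<close> of nonzero eigenvalue. Being orthogonal to every \<open>b i\<close> too, it
      is orthogonal to itself.\<close>
    define z where "z = y w - (\<Sum>i<rank B. cinner (b i) (y w) *s b i)"
    have bz: "cinner (b i) z = 0" if "i < rank B" for i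
      using that by (simp add: z_def cinner_diff_right cinner_sum_right cinner_scale_right
          orthonormal_familyD [OF b_orth] if_distrib cong: if_cong)
    have "B *v z = 0"
      by (rule hermitian_eigenvectors_span_range [where b = b and mu = mu])
        (auto intro: adjB b_eig b_orth bz dest: mu_pos)
    then have "cinner z (B *v y w) = 0"
      by (simp add: cinner_adj adjB)
    then have "cinner z (y w) = 0"
      using Yw(2) [OF w] by (simp add: By [OF w] cinner_scale_right)
    moreover have "cinner z (\<Sum>i<rank B. cinner (b i) (y w) *s b i) = 0"
    proof -
      have "cinner z (b i) = 0" if "i < rank B" for i
        using bz [OF that] cinner_commute [of "b i" z] by simp
      then show ?thesis by (simp add: cinner_sum_right cinner_scale_right)
    qed
    ultimately have "cinner z z = 0"
      by (subst (2) z_def) (simp add: cinner_diff_right)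
    then have "z = 0" by (simp add: cinner_self)
    then show ?thesis by (simp add: z_def)
  qed
  have eig_match: "l i = l' w"
    if "adj T = T" "T *v u i = complex_of_real (l i) *s u i" "T *v v w = complex_of_real (l' w) *s v w"
      "cinner (u i) (v w) \<noteq> 0" for T :: "complex^'n^'n" and u v l l' i w
  proof -
    have "complex_of_real (l' w) * cinner (u i) (v w) = complex_of_real (l i) * cinner (u i) (v w)"
      using cinner_adj [of "u i" T "v w"] that(1-3) by (simp add: cinner_scale_left cinner_scale_right)
    then show ?thesis using that(4) by simp
  qed
  have mu_match: "mu i = mu' w" if "w \<in> J" "i \<in> {..<rank B}" "cinner (b i) (y w) \<noteq> 0" for w i
    using that(3) by (rule eig_match [OF adjB, rotated 2]) (use b_eig By that in auto)
  obtain g where g: "inj_on g J" "g ` J \<subseteq> {..<rank B}" "\<And>w. w \<in> J \<Longrightarrow> mu (g w) = mu' w"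
    using orthonormal_eigenvalue_matching [OF y_orth b_orth, of mu mu', OF y_expand mu_match] by blast
  have J_orth: "orthonormal_family J (\<lambda>w. w)"
    using orthonormal_familyD [OF S(2)] Jpos(1) by (simp add: orthonormal_family_def)
  have a_expand: "v = (\<Sum>i<CARD('s). cinner (a i) v *s a i)" for v
    by (rule orthonormal_card_expansion) (simp add: orthonormal_familyD [OF a_orth])
  have alpha_match: "alpha i = al w" if "w \<in> J" "i \<in> {..<CARD('s)}" "cinner (a i) w \<noteq> 0" for w i
    using that(3) by (rule eig_match [OF adjA, rotated 2]) (use a_eig al Jpos(1) that in auto)
  obtain f where f: "inj_on f J" "f ` J \<subseteq> {..<CARD('s)}" "\<And>w. w \<in> J \<Longrightarrow> alpha (f w) = al w"
    using orthonormal_eigenvalue_matching [OF J_orth a_orth, of alpha al, OF a_expand alpha_match] by blast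
  \<comment> \<open>The whitened variable of a mode: its gain is \<open>relay_gain\<close> at
    \<open>p w\<close>, and its power c |Y w|^2 equals p / mu' by \<open>m_eq\<close>.\<close>
  define p where "p w = c w * m w" for w
  have p_nonneg: "0 \<le> p w" if "w \<in> J" for w
    using Jpos [OF that] c_pos [of w] by (simp add: p_def)
  obtain q p' where q: "q \<le> CARD('s)" "q \<le> rank B" "\<And>i. i < q \<Longrightarrow> 0 \<le> p' i"
    and cost: "(\<Sum>i<q. p' i / mu i) \<le> (\<Sum>w\<in>J. p w / mu (g w))"
    and gain: "(\<Sum>w\<in>J. relay_gain k (alpha (f w)) (p w)) \<le> (\<Sum>i<q. relay_gain k (alpha i) (p' i))"
    using relay_gain_rearrangement [where alpha = alpha and mu = mu and p = p, OF \<open>finite J\<close> p_nonneg \<open>0 \<le> k\<close> alpha_nonneg alpha_sorted mu_pos mu_sorted f(1,2) g(1,2)]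
    by blast
  have "(\<Sum>w\<in>J. p w / mu (g w)) = (\<Sum>w\<in>J. c w * (norm (Y *v w))\<^sup>2)"
    using Yw by (intro sum.cong refl) (simp add: g(3) p_def m_eq less_imp_neq [symmetric])
  \<comment> \<open>The modes outside \<open>J\<close> have no gain but nonnegative power, so
    leaving them out relaxes the budget.\<close>
  also have "\<dots> \<le> (\<Sum>w\<in>S. c w * (norm (Y *v w))\<^sup>2)"
    using S(1) \<open>J \<subseteq> S\<close> c_pos by (intro sum_mono2) (auto simp: less_imp_le)
  also have "\<dots> = relay_power k H1 Y"
    unfolding basis(5) c_def ..
  finally have "(\<Sum>i<q. p' i / mu i) \<le> P"
    using cost Y by linarith
  moreover have "H1 \<bullet> H1 - H1 \<bullet> (resolvent (H2 ** Z) ** H1) \<le> (\<Sum>i<q. relay_gain k (alpha i) (p' i))"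
  proof -
    have "H1 \<bullet> H1 - H1 \<bullet> (resolvent (H2 ** Z) ** H1) \<le> H1 \<bullet> H1 - H1 \<bullet> (resolvent (H2 ** Y) ** H1)"
      using opt [OF Z] by simp
    also have "\<dots> = (\<Sum>w\<in>S. al w * m w / (1 + m w))"
      by (rule basis(4))
    also have "\<dots> = (\<Sum>w\<in>J. al w * m w / (1 + m w))"
      using S(1) by (intro sum.mono_neutral_right) (auto simp: J_def)
    also have "\<dots> = (\<Sum>w\<in>J. relay_gain k (alpha (f w)) (p w))"
    proof (intro sum.cong refl)
      fix w assume w: "w \<in> J"
      have "1 + k * al w + p w = c w * (1 + m w)"
        by (simp add: p_def c_def algebra_simps)
      then show "al w * m w / (1 + m w) = relay_gain k (alpha (f w)) (p w)"
        using c_pos [OF Jpos(1) [OF w]] by (simp add: relay_gain_def f(3) [OF w] p_def)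
    qed
    finally show ?thesis using gain by linarith
  qed
  ultimately show ?thesis
    using that q by blast
qed

text \<open>\<open>X\<close> sends \<open>a j\<close> to a multiple of \<open>b j\<close>, B scales
  it by \<open>mu j\<close>, and the adjoint of \<open>X\<close> sends it back; the factors combine
  to \<open>x j\<close>. Thus \<open>x\<close> is the list of eigenvalues of the Gram matrix, padded
  with zeros.\<close>

lemma aligned_relay_eigenbasis:
  fixes H2 :: "complex^'u^'r" and a :: "nat \<Rightarrow> complex^'s" and b :: "nat \<Rightarrow> complex^'u" and x mu :: "nat \<Rightarrow> real"
  defines "B \<equiv> adj H2 ** H2"
  assumes "r \<le> CARD('s)" "r \<le> rank B"
    and a_orth: "orthonormal_family {..<CARD('s)} a"
    and b_eig: "\<And>i. i < rank B \<Longrightarrow> B *v b i = complex_of_real (mu i) *s b i"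
    and b_orth: "orthonormal_family {..<rank B} b"
    and mu_pos: "\<And>i. i < rank B \<Longrightarrow> 0 < mu i" and x: "\<And>i. i < r \<Longrightarrow> 0 \<le> x i"
  defines "X \<equiv> \<Sum>i<r. sqrt (x i / mu i) *\<^sub>R outer (b i) (a i)"
  assumes j: "j < CARD('s)"
  shows "X *v a j = (if j < r then sqrt (x j / mu j) *\<^sub>R b j else 0)"
    and "(adj (H2 ** X) ** (H2 ** X)) *v a j = complex_of_real (if j < r then x j else 0) *s a j"
proof -
  have "X *v a j = (\<Sum>i<r. if i = j then sqrt (x i / mu i) *\<^sub>R b i else 0)"
    unfolding X_def sum_matrix_vector_mult
    using j \<open>r \<le> CARD('s)\<close>
    by (intro sum.cong refl) (simp add: matrix_vector_mult_scaleR_left outer_matrix_vector_mult orthonormal_familyD [OF a_orth])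
  then show Xa: "X *v a j = (if j < r then sqrt (x j / mu j) *\<^sub>R b j else 0)"
    by simp
  have Xb: "adj X *v b j = sqrt (x j / mu j) *\<^sub>R a j" if "j < r"
  proof -
    have "adj X *v b j = (\<Sum>i<r. if i = j then sqrt (x i / mu i) *\<^sub>R a i else 0)"
      unfolding X_def sum_matrix_vector_mult adj_sum adj_scaleR adj_outer
      using that \<open>r \<le> rank B\<close>
      by (intro sum.cong refl) (simp add: matrix_vector_mult_scaleR_left outer_matrix_vector_mult orthonormal_familyD [OF b_orth])
    then show ?thesis using that by simp
  qed
  have "(adj (H2 ** X) ** (H2 ** X)) *v a j = adj X *v (B *v (X *v a j))"
    by (simp add: B_def adj_mult matrix_mul_assoc matrix_vector_mul_assoc)
  also have "\<dots> = complex_of_real (if j < r then x j else 0) *s a j"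
  proof (cases "j < r")
    case True
    then have jB: "j < rank B" using \<open>r \<le> rank B\<close> by simp
    have "adj X *v (B *v (X *v a j)) = (sqrt (x j / mu j) * mu j * sqrt (x j / mu j)) *\<^sub>R a j"
      using True by (simp add: Xa matrix_vector_mult_scaleR_right b_eig [OF jB] smult_of_real Xb)
    also have "sqrt (x j / mu j) * mu j * sqrt (x j / mu j) = x j"
      using x [OF True] mu_pos [OF jB] by (simp add: real_sqrt_mult_self mult.commute mult.left_commute)
    finally show ?thesis using True by (simp add: smult_of_real)
  qed (simp add: Xa)
  finally show "(adj (H2 ** X) ** (H2 ** X)) *v a j = complex_of_real (if j < r then x j else 0) *s a j" .
qed

text \<open>\<open>R\<close> and \<open>H0\<close> enter only through an increasing outer function,
  which is why one and the same matrix is optimal for every rate.\<close>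

lemma C_OSTBC_eq:
  fixes H0 :: "complex^'t^'r" and H1 :: "complex^'t^'s" and H2 :: "complex^'u^'r" and X :: "complex^'s^'u"
  shows "C_OSTBC R P1 H0 H1 H2 X = R * log 2 (1 + P1 / (real CARD('t) * R) *
    (H0 \<bullet> H0 + (H1 \<bullet> H1 - H1 \<bullet> (resolvent (H2 ** X) ** H1))))"
proof -
  have "adj H1 ** adj X ** adj H2 ** matrix_inv (mat 1 + H2 ** X ** adj X ** adj H2) ** H2 ** X ** H1
      = adj H1 ** (adj (H2 ** X) ** matrix_inv (mat 1 + (H2 ** X) ** adj (H2 ** X)) ** (H2 ** X)) ** H1"
    by (simp add: adj_mult matrix_mul_assoc)
  also have "\<dots> = adj H1 ** ((mat 1 - resolvent (H2 ** X)) ** H1)"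
    unfolding push_through by (simp add: matrix_mul_assoc)
  finally have eq: "adj H1 ** adj X ** adj H2 ** matrix_inv (mat 1 + H2 ** X ** adj X ** adj H2) ** H2 ** X ** H1
      = adj H1 ** ((mat 1 - resolvent (H2 ** X)) ** H1)" .
  have "Re (trace (adj H1 ** ((mat 1 - resolvent (H2 ** X)) ** H1))) = H1 \<bullet> H1 - H1 \<bullet> (resolvent (H2 ** X) ** H1)"
    unfolding Re_trace_adj by (simp add: matrix_ring_simps inner_diff_right)
  then show ?thesis
    unfolding C_OSTBC_def eq trace_add by (simp add: Re_trace_adj)
qed

theorem theorem2:
  fixes P1 P2 :: real
    and H0 :: "complex^'t::finite^'r::finite"
    and H1 :: "complex^'t^'s::finite"
    and H2 :: "complex^'u::finite^'r"
    and a :: "nat \<Rightarrow> complex^'s" and alpha :: "nat \<Rightarrow> real"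
    and b :: "nat \<Rightarrow> complex^'u" and mu :: "nat \<Rightarrow> real"
    and x :: "nat \<Rightarrow> real"
  defines "A \<equiv> H1 ** adj H1"
    and "B \<equiv> adj H2 ** H2"
    and "C \<equiv> mat 1 + (P1 / real CARD('t)) *\<^sub>R (H1 ** adj H1)"
    and "rhoB \<equiv> rank (adj H2 ** H2)"
  defines "rho \<equiv> min CARD('s) rhoB"
  defines "beta \<equiv> (\<lambda>i. Re (cinner (a i) (C *v a i)) / mu i)"
  assumes P1pos: "P1 > 0" and P2pos: "P2 > 0"
    and a_eig: "\<And>i. i < CARD('s) \<Longrightarrow> A *v a i = complex_of_real (alpha i) *s a i"
    and a_orth: "\<And>i j. i < CARD('s) \<Longrightarrow> j < CARD('s) \<Longrightarrow>
                   cinner (a i) (a j) = (if i = j then 1 else 0)"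
    and alpha_sorted: "\<And>i j. i \<le> j \<Longrightarrow> j < CARD('s) \<Longrightarrow> alpha j \<le> alpha i"
    and b_eig: "\<And>i. i < rhoB \<Longrightarrow> B *v b i = complex_of_real (mu i) *s b i"
    and b_orth: "\<And>i j. i < rhoB \<Longrightarrow> j < rhoB \<Longrightarrow>
                   cinner (b i) (b j) = (if i = j then 1 else 0)"
    and mu_pos: "\<And>i. i < rhoB \<Longrightarrow> mu i > 0"
    and mu_sorted: "\<And>i j. i \<le> j \<Longrightarrow> j < rhoB \<Longrightarrow> mu j \<le> mu i"
    and x_feas: "(\<Sum>i<rho. beta i * x i) \<le> P2" "\<And>i. i < rho \<Longrightarrow> x i \<ge> 0"
    and x_opt: "\<And>y. (\<Sum>i<rho. beta i * y i) \<le> P2 \<Longrightarrow> (\<forall>i<rho. y i \<ge> 0) \<Longrightarrow>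
                  (\<Sum>i<rho. alpha i / (1 + x i)) \<le> (\<Sum>i<rho. alpha i / (1 + y i))"
  shows "let X = (\<Sum>i<rho. sqrt (x i / mu i) *\<^sub>R outer (b i) (a i))
         in Re (trace (X ** C ** adj X)) \<le> P2 \<and>
            (\<forall>R>0. \<forall>Y :: complex^'s^'u. Re (trace (Y ** C ** adj Y)) \<le> P2 \<longrightarrow>
                C_OSTBC R P1 H0 H1 H2 Y \<le> C_OSTBC R P1 H0 H1 H2 X)"
proof -
  define k where "k = P1 / real CARD('t)"
  have "0 \<le> k" using P1pos by (simp add: k_def)
  have rhoB: "rhoB = rank B" by (simp add: rhoB_def B_def)
  have C: "C = mat 1 + k *\<^sub>R (H1 ** adj H1)" by (simp add: C_def k_def)
  have oa: "orthonormal_family {..<CARD('s)} a" and ob: "orthonormal_family {..<rank (adj H2 ** H2)} b"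
    using a_orth b_orth by (auto simp: orthonormal_family_def rhoB_def)
  have rho_le: "rho \<le> CARD('s)" "rho \<le> rank (adj H2 ** H2)"
    by (simp_all add: rho_def rhoB_def)
  have a_expand: "v = (\<Sum>i<CARD('s). cinner (a i) v *s a i)" for v
    by (rule orthonormal_card_expansion) (simp add: a_orth)
  define X where "X = (\<Sum>i<rho. sqrt (x i / mu i) *\<^sub>R outer (b i) (a i))"
  \<comment> \<open>The sums over an eigenbasis need all CARD('s) modes; those beyond
    \<open>rho\<close> receive no power.\<close>
  define xx where "xx i = (if i < rho then x i else 0)" for i
  have Xa: "X *v a i = (if i < rho then sqrt (x i / mu i) *\<^sub>R b i else 0)" if "i < CARD('s)" for i
    using rho_le oa b_eig ob mu_pos x_feas(2) that unfolding X_def B_def rhoB_def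
    by (intro aligned_relay_eigenbasis(1)) auto
  have "(adj (H2 ** X) ** (H2 ** X)) *v a i = complex_of_real (xx i) *s a i" if "i < CARD('s)" for i
    using rho_le oa b_eig ob mu_pos x_feas(2) that unfolding X_def xx_def B_def rhoB_def
    by (intro aligned_relay_eigenbasis(2)) auto
  then have XM: "\<forall>i\<in>{..<CARD('s)}. (adj (H2 ** X) ** (H2 ** X)) *v a i = complex_of_real (xx i) *s a i"
    by simp
  have A_eig: "\<forall>i\<in>{..<CARD('s)}. (H1 ** adj H1) *v a i = complex_of_real (alpha i) *s a i"
    using a_eig by (simp add: A_def)
  note basis = resolvent_objective_eigenbasis [OF finite_lessThan a_expand oa A_eig XM]
  have alpha_nonneg: "0 \<le> alpha i" if "i < CARD('s)" for i
    using basis(2) that by simp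
  have c_pos: "0 < 1 + k * alpha i" if "i < CARD('s)" for i
    using alpha_nonneg [OF that] \<open>0 \<le> k\<close> by (simp add: add_pos_nonneg)
  have beta: "beta i = (1 + k * alpha i) / mu i" if "i < CARD('s)" for i
  proof -
    have "C *v a i = complex_of_real (1 + k * alpha i) *s a i"
      using A_eig that by (simp add: C matrix_vector_mult_add_rdistrib matrix_vector_mult_scaleR_left vector_smult_assoc flip: smult_of_real)
    then have "cinner (a i) (C *v a i) = complex_of_real (1 + k * alpha i)"
      using a_orth [OF that that] by (simp only: cinner_scale_right) simp
    then show ?thesis by (simp add: beta_def)
  qed
  have "relay_power k H1 X = (\<Sum>i<CARD('s). (1 + k * alpha i) * (norm (X *v a i))\<^sup>2)"
    by (rule basis(5))
  also have "\<dots> = (\<Sum>i<rho. (1 + k * alpha i) * (norm (X *v a i))\<^sup>2)"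
    using rho_le Xa by (intro sum.mono_neutral_right) auto
  also have "\<dots> = (\<Sum>i<rho. beta i * x i)"
  proof (intro sum.cong refl)
    fix i assume "i \<in> {..<rho}"
    then have i: "i < rho" "i < CARD('s)" "i < rhoB" using rho_le by (auto simp: rhoB_def)
    have "norm (b i) = 1"
      using b_orth [OF i(3) i(3)] by (simp add: norm_eq_1 flip: Re_cinner)
    then show "(1 + k * alpha i) * (norm (X *v a i))\<^sup>2 = beta i * x i"
      using i x_feas(2) [OF i(1)] mu_pos [OF i(3)] by (simp add: Xa beta)
  qed
  finally have X_power: "relay_power k H1 X \<le> P2" using x_feas(1) by simp
  have "H1 \<bullet> H1 - H1 \<bullet> (resolvent (H2 ** X) ** H1) = (\<Sum>i<CARD('s). alpha i * xx i / (1 + xx i))"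
    by (rule basis(4))
  also have "\<dots> = (\<Sum>i<rho. alpha i * x i / (1 + x i))"
    using rho_le by (subst sum.mono_neutral_right [of "{..<CARD('s)}" "{..<rho}"]) (auto simp: xx_def)
  finally have X_gain: "H1 \<bullet> H1 - H1 \<bullet> (resolvent (H2 ** X) ** H1) = (\<Sum>i<rho. alpha i * x i / (1 + x i))" .
  \<comment> \<open>Links maximal gain with the minimization that defines \<open>x\<close>.\<close>
  have split: "(\<Sum>i<rho. alpha i * z i / (1 + z i)) = (\<Sum>i<rho. alpha i) - (\<Sum>i<rho. alpha i / (1 + z i))"
    if "\<And>i. i < rho \<Longrightarrow> 0 \<le> z i" for z
  proof -
    have "alpha i * z i / (1 + z i) = alpha i - alpha i / (1 + z i)" if "i < rho" for i
    proof -
      have "1 + z i \<noteq> 0" using \<open>\<And>i. i < rho \<Longrightarrow> 0 \<le> z i\<close> [OF that] by simp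
      then show ?thesis by (simp add: field_simps)
    qed
    then show ?thesis by (simp add: sum_subtractf)
  qed
  have best: "H1 \<bullet> H1 - H1 \<bullet> (resolvent (H2 ** Y) ** H1) \<le> H1 \<bullet> H1 - H1 \<bullet> (resolvent (H2 ** X) ** H1)"
    if Y: "relay_power k H1 Y \<le> P2" for Y :: "complex^'s^'u"
  proof -
    obtain q p where q: "q \<le> CARD('s)" "q \<le> rank (adj H2 ** H2)" and p: "\<And>i. i < q \<Longrightarrow> 0 \<le> p i"
      and cost: "(\<Sum>i<q. p i / mu i) \<le> P2"
      and gain: "H1 \<bullet> H1 - H1 \<bullet> (resolvent (H2 ** Y) ** H1) \<le> (\<Sum>i<q. relay_gain k (alpha i) (p i))"
      using relay_gain_upper_bound [where alpha = alpha and mu = mu and a = a and b = b, OF \<open>0 \<le> k\<close> less_imp_le [OF P2pos] a_eig [unfolded A_def] oa alpha_nonneg alpha_sorted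
          b_eig [unfolded B_def rhoB_def] ob mu_pos [unfolded rhoB_def] mu_sorted [unfolded rhoB_def] Y] by blast
    have "q \<le> rho" using q by (simp add: rho_def rhoB_def)
    \<comment> \<open>Undoes the whitening: \<open>beta i * y i\<close> becomes
      \<open>p i / mu i\<close> and the gain in \<open>y\<close> becomes \<open>relay_gain\<close>.
      Zeros fill up the modes from \<open>q\<close> to \<open>rho\<close>, giving a competitor in
      the scalar problem.\<close>
    define y where "y i = (if i < q then p i / (1 + k * alpha i) else 0)" for i
    have y_nonneg: "0 \<le> y i" for i
      using p c_pos q by (auto simp: y_def intro!: divide_nonneg_pos)
    have "(\<Sum>i<rho. beta i * y i) = (\<Sum>i<q. beta i * y i)"
      using \<open>q \<le> rho\<close> by (intro sum.mono_neutral_right) (auto simp: y_def)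
    also have "\<dots> = (\<Sum>i<q. p i / mu i)"
    proof (intro sum.cong refl)
      fix i assume "i \<in> {..<q}"
      then show "beta i * y i = p i / mu i"
        using q c_pos [of i] by (simp add: beta y_def)
    qed
    finally have "(\<Sum>i<rho. beta i * y i) \<le> P2" using cost by simp
    then have "(\<Sum>i<rho. alpha i / (1 + x i)) \<le> (\<Sum>i<rho. alpha i / (1 + y i))"
      using y_nonneg by (intro x_opt) auto
    then have "(\<Sum>i<rho. alpha i * y i / (1 + y i)) \<le> (\<Sum>i<rho. alpha i * x i / (1 + x i))"
      using split [of x] split [of y] x_feas(2) y_nonneg by simp
    moreover have "(\<Sum>i<rho. alpha i * y i / (1 + y i)) = (\<Sum>i<q. relay_gain k (alpha i) (p i))"
    proof -
      have "(\<Sum>i<rho. alpha i * y i / (1 + y i)) = (\<Sum>i<q. alpha i * y i / (1 + y i))"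
        using \<open>q \<le> rho\<close> by (intro sum.mono_neutral_right) (auto simp: y_def)
      also have "\<dots> = (\<Sum>i<q. relay_gain k (alpha i) (p i))"
      proof (intro sum.cong refl)
        fix i assume i: "i \<in> {..<q}"
        then have c: "0 < 1 + k * alpha i" and yi: "y i = p i / (1 + k * alpha i)" and "0 \<le> p i"
          using q c_pos [of i] p by (auto simp: y_def)
        then have "1 + y i = (1 + k * alpha i + p i) / (1 + k * alpha i)"
          by (simp add: add_divide_distrib)
        then show "alpha i * y i / (1 + y i) = relay_gain k (alpha i) (p i)"
          using c by (simp add: yi relay_gain_def)
      qed
      finally show ?thesis .
    qed
    ultimately show ?thesis
      using gain X_gain by linarith
  qed
  have "C_OSTBC R P1 H0 H1 H2 Y \<le> C_OSTBC R P1 H0 H1 H2 X"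
    if "0 < R" and Y: "relay_power k H1 Y \<le> P2" for R and Y :: "complex^'s^'u"
  proof -
    let ?g = "\<lambda>Y. H0 \<bullet> H0 + (H1 \<bullet> H1 - H1 \<bullet> (resolvent (H2 ** Y) ** H1))"
    \<comment> \<open>Keeps the argument of the logarithm at least 1, so that monotonicity of the
      logarithm applies.\<close>
    have "0 \<le> H1 \<bullet> H1 - H1 \<bullet> (resolvent (H2 ** Y) ** H1)"
      using one_minus_resolvent_nonneg [of H1 "H2 ** Y"] by (simp add: matrix_ring_simps inner_diff_right)
    then have "0 \<le> ?g Y" by simp
    moreover have "?g Y \<le> ?g X" using best [OF Y] by simp
    moreover have r: "0 \<le> P1 / (real CARD('t) * R)" using P1pos \<open>0 < R\<close> by simp
    ultimately have "0 \<le> P1 / (real CARD('t) * R) * ?g Y"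
      "P1 / (real CARD('t) * R) * ?g Y \<le> P1 / (real CARD('t) * R) * ?g X"
      by (auto intro!: mult_nonneg_nonneg mult_left_mono simp del: times_divide_eq_left)
    then have "log 2 (1 + P1 / (real CARD('t) * R) * ?g Y) \<le> log 2 (1 + P1 / (real CARD('t) * R) * ?g X)"
      by (intro log_mono) auto
    then show ?thesis
      unfolding C_OSTBC_eq using \<open>0 < R\<close> by (intro mult_left_mono) auto
  qed
  then show ?thesis
    using X_power unfolding Let_def C X_def [symmetric] relay_power_trace by blast
qed

end
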